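(* Let $K$ be a field of characteristic zero, $X=K^2$ with coordinates $x,y$, and let $f = x^m + y^l \in K[x,y]$ with positive integers $l,m$. Then the multiplicity of the left $D_X$-module $K[x,y,f^{-1}]$ equals $2\max\{l,m\}$.
   Context: $D_X=K[x,y]\langle\partial_x,\partial_y\rangle$ is the Weyl algebra in the two variables $x,y$. Multiplicity (in the sense of Bernstein): let $F_k(D_X)$ be the $K$-span of monomials $x^{\alpha_1}y^{\alpha_2}\partial_x^{\beta_1}\partial_y^{\beta_2}$ with $\alpha_1+\alpha_2+\beta_1+\beta_2\le k$. A good Bernstein filtration on a finitely generated left $D_X$-module $N$ is a family of the form $F_k(N)=F_{k-k_1}(D_X)u_1+\cdots+F_{k-k_r}(D_X)u_r$ ($k\in\mathbb{Z}$) with $u_1,\dots,u_r$ generating $N$. For $k\gg0$, $\dim_KF_k(N)$ is a polynomial in $k$ with leading term $c_dk^d$; $d$ is the dimension of $N$ and $d!\,c_d$ is the multiplicity of $N$, both independent of the good filtration. *)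

theory Defs
  imports Complex_Main "HOL-Computational_Algebra.Computational_Algebra"
begin

section \<open>The Weyl algebra in two variables\<close>

text \<open>The \<open>K\<close>-algebra presented by the generators \<open>x, y, \<partial>\<^sub>x, \<partial>\<^sub>y\<close> and the Weyl relations:
  terms in the generators modulo the least congruence containing the axioms of
  \<open>K\<close>-algebras and the relations. Negation of \<open>p\<close> is \<open>(-1) p\<close>.\<close>

datatype 'k weyl_term =
    Const 'k | GenX | GenY | GenDx | GenDy
  | Add "'k weyl_term" "'k weyl_term"
  | Mul "'k weyl_term" "'k weyl_term"

inductive weyl_eq :: "'k::field weyl_term \<Rightarrow> 'k weyl_term \<Rightarrow> bool" where
  refl: "weyl_eq p p"
| sym: "weyl_eq p q \<Longrightarrow> weyl_eq q p"
| trans: "weyl_eq p q \<Longrightarrow> weyl_eq q r \<Longrightarrow> weyl_eq p r"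
| add_cong: "weyl_eq p p' \<Longrightarrow> weyl_eq q q' \<Longrightarrow> weyl_eq (Add p q) (Add p' q')"
| mul_cong: "weyl_eq p p' \<Longrightarrow> weyl_eq q q' \<Longrightarrow> weyl_eq (Mul p q) (Mul p' q')"
| add_assoc: "weyl_eq (Add (Add p q) r) (Add p (Add q r))"
| add_comm: "weyl_eq (Add p q) (Add q p)"
| add_zero: "weyl_eq (Add (Const 0) p) p"
| mul_assoc: "weyl_eq (Mul (Mul p q) r) (Mul p (Mul q r))"
| distrib_right: "weyl_eq (Mul (Add p q) r) (Add (Mul p r) (Mul q r))"
| distrib_left: "weyl_eq (Mul p (Add q r)) (Add (Mul p q) (Mul p r))"
| mul_one: "weyl_eq (Mul (Const 1) p) p"
| mul_zero: "weyl_eq (Mul (Const 0) p) (Const 0)"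
| const_add: "weyl_eq (Const (a + b)) (Add (Const a) (Const b))"
| const_mul: "weyl_eq (Const (a * b)) (Mul (Const a) (Const b))"
| const_central: "weyl_eq (Mul p (Const a)) (Mul (Const a) p)"
| x_y: "weyl_eq (Mul GenX GenY) (Mul GenY GenX)"
| dx_dy: "weyl_eq (Mul GenDx GenDy) (Mul GenDy GenDx)"
| dx_x: "weyl_eq (Mul GenDx GenX) (Add (Mul GenX GenDx) (Const 1))"
| dy_y: "weyl_eq (Mul GenDy GenY) (Add (Mul GenY GenDy) (Const 1))"
| dx_y: "weyl_eq (Mul GenDx GenY) (Mul GenY GenDx)"
| dy_x: "weyl_eq (Mul GenDy GenX) (Mul GenX GenDy)"

lemma equivp_weyl_eq: "equivp weyl_eq"
  by (intro equivpI reflpI sympI transpI) (blast intro: weyl_eq.intros)+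

quotient_type (overloaded) 'k weyl = "'k::field weyl_term" / weyl_eq
  by (rule equivp_weyl_eq)

lift_definition weyl_const :: "'k::field \<Rightarrow> 'k weyl" is Const .
lift_definition weyl_x :: "'k::field weyl" is GenX .
lift_definition weyl_y :: "'k::field weyl" is GenY .
lift_definition weyl_dx :: "'k::field weyl" is GenDx .
lift_definition weyl_dy :: "'k::field weyl" is GenDy .


section \<open>The action on rational functions\<close>

text \<open>\<open>K[x,y]\<close> is rendered as \<open>K[x][y]\<close>: the inner variable is \<open>x\<close>, the outer one \<open>y\<close>.\<close>

definition poly_x :: "'k::field poly poly" where "poly_x = [:[:0, 1:]:]"
definition poly_y :: "'k::field poly poly" where "poly_y = [:0, 1:]"

definition poly_dx :: "'k::field poly poly \<Rightarrow> 'k poly poly" where "poly_dx p = map_poly pderiv p"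
definition poly_dy :: "'k::field poly poly \<Rightarrow> 'k poly poly" where "poly_dy p = pderiv p"

lemma coeff_poly_dx: "coeff (poly_dx p) n = pderiv (coeff p n)"
  by (simp add: poly_dx_def coeff_map_poly)

lemma pderiv_sum_distrib: "pderiv (sum f A) = (\<Sum>i\<in>A. pderiv (f i))"
  by (induction A rule: infinite_finite_induct) (simp_all add: pderiv_add)

lemma poly_dx_add: "poly_dx (p + q) = poly_dx p + poly_dx q"
  by (rule poly_eqI) (simp add: coeff_poly_dx pderiv_add)

lemma poly_dx_mult: "poly_dx (p * q) = poly_dx p * q + p * poly_dx q"
  by (rule poly_eqI)
    (simp add: coeff_poly_dx coeff_mult pderiv_sum_distrib pderiv_mult sum.distrib
      mult.commute[of _ "pderiv _"] add.commute)

lemma poly_dy_add: "poly_dy (p + q) = poly_dy p + poly_dy q"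
  by (simp add: poly_dy_def pderiv_add)

lemma poly_dy_mult: "poly_dy (p * q) = poly_dy p * q + p * poly_dy q"
  by (simp add: poly_dy_def pderiv_mult algebra_simps)

lemma poly_dx_dy: "poly_dx (poly_dy p) = poly_dy (poly_dx p)"
proof (rule poly_eqI)
  fix n
  have *: "pderiv (of_nat k * r) = of_nat k * pderiv r" for k and r :: "'a poly"
    by (simp add: pderiv_mult)
  show "coeff (poly_dx (poly_dy p)) n = coeff (poly_dy (poly_dx p)) n"
    by (simp only: coeff_poly_dx poly_dy_def coeff_pderiv *)
qed

definition derivation :: "('a::idom \<Rightarrow> 'a) \<Rightarrow> bool" where
  "derivation d \<longleftrightarrow> (\<forall>p q. d (p + q) = d p + d q) \<and> (\<forall>p q. d (p * q) = d p * q + p * d q)"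

lemma quotient_rule_wd:
  fixes d :: "'a::idom \<Rightarrow> 'a"
  assumes "derivation d" and eq: "a * b' = a' * b"
  shows "(d a * b - a * d b) * (b' * b') = (d a' * b' - a' * d b') * (b * b)"
proof -
  have D: "d a * b' + a * d b' = d a' * b + a' * d b"
    using arg_cong[OF eq, of d] assms(1) by (simp add: derivation_def)
  have "(d a * b - a * d b) * (b' * b') - (d a' * b' - a' * d b') * (b * b)
      = b * b' * ((d a * b' + a * d b') - (d a' * b + a' * d b))
        - (b' * d b + b * d b') * (a * b' - a' * b)"
    by (simp add: algebra_simps)
  then show ?thesis
    by (simp add: D eq)
qed

text \<open>The extension of a derivation to the fraction field by the quotient rule.\<close>

definition fract_deriv :: "('a::idom \<Rightarrow> 'a) \<Rightarrow> 'a fract \<Rightarrow> 'a fract" where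
  "fract_deriv d u =
     (THE v. \<forall>a b. b \<noteq> 0 \<longrightarrow> u = Fract a b \<longrightarrow> v = Fract (d a * b - a * d b) (b * b))"

lemma fract_deriv_Fract:
  assumes "derivation d" "b \<noteq> 0"
  shows "fract_deriv d (Fract a b) = Fract (d a * b - a * d b) (b * b)"
  unfolding fract_deriv_def
proof (rule the_equality)
  show "\<forall>a' b'. b' \<noteq> 0 \<longrightarrow> Fract a b = Fract a' b' \<longrightarrow>
      Fract (d a * b - a * d b) (b * b) = Fract (d a' * b' - a' * d b') (b' * b')"
    using assms by (auto simp: eq_fract intro!: quotient_rule_wd)
qed (use assms in blast)

lemma derivation_poly_dx: "derivation poly_dx"
  by (simp add: derivation_def poly_dx_add poly_dx_mult)

lemma derivation_poly_dy: "derivation poly_dy"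
  by (simp add: derivation_def poly_dy_add poly_dy_mult)

definition ratfun_dx :: "'k::field poly poly fract \<Rightarrow> 'k poly poly fract" where
  "ratfun_dx = fract_deriv poly_dx"

definition ratfun_dy :: "'k::field poly poly fract \<Rightarrow> 'k poly poly fract" where
  "ratfun_dy = fract_deriv poly_dy"

lemma ratfun_dx_Fract:
  "b \<noteq> 0 \<Longrightarrow> ratfun_dx (Fract a b) = Fract (poly_dx a * b - a * poly_dx b) (b * b)"
  by (simp add: ratfun_dx_def fract_deriv_Fract derivation_poly_dx)

lemma ratfun_dy_Fract:
  "b \<noteq> 0 \<Longrightarrow> ratfun_dy (Fract a b) = Fract (poly_dy a * b - a * poly_dy b) (b * b)"
  by (simp add: ratfun_dy_def fract_deriv_Fract derivation_poly_dy)

lemma ratfun_dx_add: "ratfun_dx (u + v) = ratfun_dx u + ratfun_dx v"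
  by (cases u; cases v)
    (simp add: ratfun_dx_Fract eq_fract poly_dx_add poly_dx_mult algebra_simps)

lemma ratfun_dy_add: "ratfun_dy (u + v) = ratfun_dy u + ratfun_dy v"
  by (cases u; cases v)
    (simp add: ratfun_dy_Fract eq_fract poly_dy_add poly_dy_mult algebra_simps)

lemma ratfun_dx_mult: "ratfun_dx (u * v) = ratfun_dx u * v + u * ratfun_dx v"
  by (cases u; cases v)
    (simp add: ratfun_dx_Fract eq_fract poly_dx_mult algebra_simps)

lemma ratfun_dy_mult: "ratfun_dy (u * v) = ratfun_dy u * v + u * ratfun_dy v"
  by (cases u; cases v)
    (simp add: ratfun_dy_Fract eq_fract poly_dy_mult algebra_simps)

lemma poly_dx_diff: "poly_dx (p - q) = poly_dx p - poly_dx q"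
  using poly_dx_add[of "p - q" q] by simp

lemma poly_dy_diff: "poly_dy (p - q) = poly_dy p - poly_dy q"
  using poly_dy_add[of "p - q" q] by simp

lemma ratfun_dx_dy: "ratfun_dx (ratfun_dy u) = ratfun_dy (ratfun_dx u)"
  by (cases u)
    (simp add: ratfun_dx_Fract ratfun_dy_Fract eq_fract poly_dx_mult poly_dy_mult
      poly_dx_diff poly_dy_diff poly_dx_dy algebra_simps)

lemma poly_d_simps [simp]:
  "poly_dx [:[:c:]:] = 0" "poly_dy [:[:c:]:] = 0"
  "poly_dx poly_x = 1" "poly_dy poly_x = 0" "poly_dx poly_y = 0" "poly_dy poly_y = 1"
  by (simp_all add: poly_dx_def poly_dy_def poly_x_def poly_y_def map_poly_pCons pderiv_pCons
      one_pCons)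

lemma poly_d_1 [simp]: "poly_dx 1 = 0" "poly_dy 1 = 0"
  using poly_d_simps(1,2)[of 1] by (simp_all flip: one_pCons)

lemma ratfun_dx_to_fract: "ratfun_dx (to_fract p) = to_fract (poly_dx p)"
  by (simp add: to_fract_def ratfun_dx_Fract)

lemma ratfun_dy_to_fract: "ratfun_dy (to_fract p) = to_fract (poly_dy p)"
  by (simp add: to_fract_def ratfun_dy_Fract)

primrec term_act :: "'k::field weyl_term \<Rightarrow> 'k poly poly fract \<Rightarrow> 'k poly poly fract" where
  "term_act (Const c) u = to_fract [:[:c:]:] * u"
| "term_act GenX u = to_fract poly_x * u"
| "term_act GenY u = to_fract poly_y * u"
| "term_act GenDx u = ratfun_dx u"
| "term_act GenDy u = ratfun_dy u"
| "term_act (Add p q) u = term_act p u + term_act q u"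
| "term_act (Mul p q) u = term_act p (term_act q u)"

lemmas ratfun_d_simps = ratfun_dx_add ratfun_dy_add ratfun_dx_mult ratfun_dy_mult
  ratfun_dx_to_fract ratfun_dy_to_fract

lemma to_fract_const_add:
  "to_fract [:[:a + b:]:] = to_fract [:[:a:]:] + to_fract [:[:b::'k::field:]:]"
  by (simp flip: to_fract_add)

lemma to_fract_const_mult:
  "to_fract [:[:a * b:]:] = to_fract [:[:a:]:] * to_fract [:[:b::'k::field:]:]"
  by (simp flip: to_fract_mult)

lemma to_fract_const_1: "to_fract [:[:1::'k::field:]:] = 1"
  by (simp flip: one_pCons)

lemma term_act_add: "term_act p (u + v) = term_act p u + term_act p v"
  by (induction p arbitrary: u v) (simp_all add: algebra_simps ratfun_dx_add ratfun_dy_add)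

lemma term_act_const: "term_act p (to_fract [:[:c:]:] * u) = to_fract [:[:c:]:] * term_act p u"
  by (induction p arbitrary: u) (simp_all add: algebra_simps ratfun_d_simps)

lemma term_act_const': "term_act p (u * to_fract [:[:c:]:]) = term_act p u * to_fract [:[:c:]:]"
  using term_act_const[of p c u] by (simp only: mult.commute)

lemma term_act_weyl_eq: "weyl_eq p q \<Longrightarrow> term_act p u = term_act q u"
  by (induction p q arbitrary: u rule: weyl_eq.induct)
    (simp_all add: term_act_add term_act_const term_act_const' to_fract_const_add to_fract_const_mult
      to_fract_const_1 ratfun_d_simps ratfun_dx_dy algebra_simps)

lift_definition ratfun_act :: "'k::field weyl \<Rightarrow> 'k poly poly fract \<Rightarrow> 'k poly poly fract"
  is term_act
  by (rule ext) (rule term_act_weyl_eq)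

section \<open>The ring structure of the Weyl algebra\<close>

text \<open>The action on rational functions is used here to see that \<open>0 \<noteq> 1\<close>.\<close>

instantiation weyl :: (field) ring_1
begin

lift_definition zero_weyl :: "'a weyl" is "Const 0" .
lift_definition one_weyl :: "'a weyl" is "Const 1" .
lift_definition plus_weyl :: "'a weyl \<Rightarrow> 'a weyl \<Rightarrow> 'a weyl" is Add
  by (rule weyl_eq.add_cong)
lift_definition times_weyl :: "'a weyl \<Rightarrow> 'a weyl \<Rightarrow> 'a weyl" is Mul
  by (rule weyl_eq.mul_cong)
definition uminus_weyl :: "'a weyl \<Rightarrow> 'a weyl" where
  "- p = weyl_const (- 1) * p"
definition minus_weyl :: "'a weyl \<Rightarrow> 'a weyl \<Rightarrow> 'a weyl" where
  "p - q = p + - (q :: 'a weyl)"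

instance
proof
  fix a b c :: "'a weyl"
  show "a * b * c = a * (b * c)" by transfer (rule weyl_eq.mul_assoc)
  show "1 * a = a" by transfer (rule weyl_eq.mul_one)
  show "a * 1 = a" by transfer (blast intro: weyl_eq.trans weyl_eq.const_central weyl_eq.mul_one)
  show "a + b + c = a + (b + c)" by transfer (rule weyl_eq.add_assoc)
  show "a + b = b + a" by transfer (rule weyl_eq.add_comm)
  show "0 + a = a" by transfer (rule weyl_eq.add_zero)
  show "(a + b) * c = a * c + b * c" by transfer (rule weyl_eq.distrib_right)
  show "a * (b + c) = a * b + a * c" by transfer (rule weyl_eq.distrib_left)
  show "a - b = a + - b" by (rule minus_weyl_def)
  have "weyl_eq (Add (Mul (Const (- 1)) p) p) (Const 0)" for p :: "'a weyl_term"
  proof -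
    have "weyl_eq (Add (Mul (Const (- 1)) p) p) (Add (Mul (Const (- 1)) p) (Mul (Const 1) p))"
      by (blast intro: weyl_eq.intros)
    moreover have "weyl_eq \<dots> (Mul (Add (Const (- 1)) (Const 1)) p)"
      by (blast intro: weyl_eq.intros)
    moreover have "weyl_eq \<dots> (Mul (Const (- 1 + 1)) p)"
      by (blast intro: weyl_eq.intros)
    moreover have "weyl_eq (Mul (Const (- 1 + 1)) p) (Const 0)"
      using weyl_eq.mul_zero[of p] by simp
    ultimately show ?thesis
      by (blast intro: weyl_eq.trans)
  qed
  then show "- a + a = 0"
    unfolding uminus_weyl_def by transfer
  have "\<not> weyl_eq (Const 0) (Const (1::'a))"
    using term_act_weyl_eq[of "Const 0" "Const (1::'a)" 1] by auto
  then show "(0 :: 'a weyl) \<noteq> 1" by transfer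
qed

end

definition weyl_scale :: "'k::field \<Rightarrow> 'k weyl \<Rightarrow> 'k weyl" where
  "weyl_scale c p = weyl_const c * p"

lemma weyl_const_simps:
  "weyl_const 0 = (0 :: 'k::field weyl)" "weyl_const 1 = (1 :: 'k weyl)"
  "weyl_const (a + b) = weyl_const a + (weyl_const b :: 'k weyl)"
  "weyl_const (a * b) = weyl_const a * (weyl_const b :: 'k weyl)"
  by (transfer; blast intro: weyl_eq.intros)+

interpretation weyl: vector_space "weyl_scale :: 'k::field \<Rightarrow> 'k weyl \<Rightarrow> 'k weyl"
  by unfold_locales (simp_all add: weyl_scale_def weyl_const_simps algebra_simps)

text \<open>\<open>F\<^sub>k(D\<^sub>X)\<close>; it is \<open>0\<close> for \<open>k < 0\<close>.\<close>

definition bernstein_filtration :: "int \<Rightarrow> 'k::field weyl set" where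
  "bernstein_filtration k = weyl.span
     {weyl_x ^ a1 * weyl_y ^ a2 * weyl_dx ^ b1 * weyl_dy ^ b2 | a1 a2 b1 b2.
       int (a1 + a2 + b1 + b2) \<le> k}"

section \<open>Good filtrations and multiplicity of left modules\<close>

text \<open>Modules are given as submodules of an ambient left module (possibly the whole of it), so
  that they need not be types.\<close>

locale weyl_module =
  fixes act :: "'k::field weyl \<Rightarrow> 'n::ab_group_add \<Rightarrow> 'n"
  assumes act_add_left: "act (p + q) u = act p u + act q u"
    and act_add_right: "act p (u + v) = act p u + act p v"
    and act_mult: "act (p * q) u = act p (act q u)"
    and act_one: "act 1 u = u"
begin

definition submodule :: "'n set \<Rightarrow> bool" where
  "submodule N \<longleftrightarrow> 0 \<in> N \<and> (\<forall>u\<in>N. \<forall>v\<in>N. u + v \<in> N) \<and> (\<forall>p. \<forall>u\<in>N. act p u \<in> N)"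

definition scale :: "'k \<Rightarrow> 'n \<Rightarrow> 'n" where
  "scale c u = act (weyl_const c) u"

sublocale vector_space scale
  by unfold_locales
    (simp_all add: scale_def weyl_const_simps act_add_left act_add_right act_mult act_one)

definition good_filtration :: "'n set \<Rightarrow> (int \<Rightarrow> 'n set) \<Rightarrow> bool" where
  "good_filtration N F \<longleftrightarrow> (\<exists>(r::nat) (u :: nat \<Rightarrow> 'n) (s :: nat \<Rightarrow> int).
     N = {\<Sum>i<r. act (P i) (u i) | P. True} \<and>
     (\<forall>k. F k = {\<Sum>i<r. act (P i) (u i) | P. \<forall>i<r. P i \<in> bernstein_filtration (k - s i)}))"

text \<open>The dimension is the degree \<open>d\<close> of the Hilbert polynomial \<open>p\<close> and the multiplicity is
  \<open>d! c\<^sub>d\<close>. Both are independent of the good filtration, so the description is unique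
  for finitely generated \<open>N\<close>; otherwise no good filtration exists and the value is unspecified.\<close>

definition bernstein_multiplicity :: "'n set \<Rightarrow> real" where
  "bernstein_multiplicity N = (THE e. \<exists>F (p :: real poly). good_filtration N F \<and>
     (\<forall>\<^sub>F k in at_top. real (dim (F k)) = poly p (of_int k)) \<and>
     e = fact (degree p) * lead_coeff p)"

end

interpretation ratfun: weyl_module "ratfun_act :: 'k::field weyl \<Rightarrow> _"
proof
  fix p q :: "'k weyl" and u v :: "'k poly poly fract"
  show "ratfun_act (p + q) u = ratfun_act p u + ratfun_act q u" by transfer simp
  show "ratfun_act p (u + v) = ratfun_act p u + ratfun_act p v" by transfer (rule term_act_add)
  show "ratfun_act (p * q) u = ratfun_act p (ratfun_act q u)" by transfer simp
  show "ratfun_act 1 u = u" by transfer (simp add: to_fract_const_1)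
qed

section \<open>The localization \<open>K[x,y,f\<^sup>-\<^sup>1]\<close>\<close>

definition localization :: "'k::field poly poly \<Rightarrow> 'k poly poly fract set" where
  "localization f = {to_fract p / to_fract f ^ n | p n. True}"

lemma localization_iff_Fract:
  assumes "f \<noteq> 0"
  shows "u \<in> localization f \<longleftrightarrow> (\<exists>p n. u = Fract p (f ^ n))"
proof -
  have "to_fract f ^ n = to_fract (f ^ n)" for n
    by (induction n) simp_all
  then show ?thesis
    by (simp add: localization_def to_fract_def)
qed

lemma localization_add:
  assumes "f \<noteq> 0" "u \<in> localization f" "v \<in> localization f"
  shows "u + v \<in> localization f"
proof -
  obtain a n b k where "u = Fract a (f ^ n)" "v = Fract b (f ^ k)"
    using assms by (auto simp: localization_iff_Fract)
  then have "u + v = Fract (a * f ^ k + b * f ^ n) (f ^ (n + k))"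
    using assms(1) by (simp add: power_add)
  then show ?thesis
    using assms(1) localization_iff_Fract by blast
qed

lemma localization_mult:
  assumes "f \<noteq> 0" "u \<in> localization f"
  shows "to_fract a * u \<in> localization f"
  using assms by (auto simp: localization_iff_Fract to_fract_def) blast

lemma term_act_localization:
  assumes f: "f \<noteq> 0"
  shows "u \<in> localization f \<Longrightarrow> term_act q u \<in> localization f"
proof (induction q arbitrary: u)
  case GenDx
  then obtain p n where "u = Fract p (f ^ n)"
    using f localization_iff_Fract by blast
  then have "ratfun_dx u = Fract (poly_dx p * f ^ n - p * poly_dx (f ^ n)) (f ^ (n + n))"
    using f by (simp add: ratfun_dx_Fract power_add)
  then show ?case
    unfolding term_act.simps localization_iff_Fract[OF f] by blast
next
  case GenDy
  then obtain p n where "u = Fract p (f ^ n)"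
    using f localization_iff_Fract by blast
  then have "ratfun_dy u = Fract (poly_dy p * f ^ n - p * poly_dy (f ^ n)) (f ^ (n + n))"
    using f by (simp add: ratfun_dy_Fract power_add)
  then show ?case
    unfolding term_act.simps localization_iff_Fract[OF f] by blast
qed (simp_all add: f localization_add localization_mult)

lemma submodule_localization:
  assumes f: "f \<noteq> 0"
  shows "ratfun.submodule (localization f)"
proof -
  have "ratfun_act p u \<in> localization f" if "u \<in> localization f" for p u
    using that by (transfer fixing: f u) (rule term_act_localization[OF f])
  moreover have "0 \<in> localization f"
    unfolding localization_def by (intro CollectI exI[of _ 0]) simp
  ultimately show ?thesis
    unfolding ratfun.submodule_def using f localization_add by blast
qed

lemma ratfun_act_simps:
  "ratfun_act (weyl_const c) u = to_fract [:[:c:]:] * u"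
  "ratfun_act weyl_x u = to_fract poly_x * u"
  "ratfun_act weyl_y u = to_fract poly_y * u"
  "ratfun_act weyl_dx u = ratfun_dx u"
  "ratfun_act weyl_dy u = ratfun_dy u"
  by (simp_all add: ratfun_act.abs_eq weyl_const.abs_eq weyl_x.abs_eq weyl_y.abs_eq
      weyl_dx.abs_eq weyl_dy.abs_eq)

end

theory Submission
  imports Defs
begin

text \<open>Exchanging \<open>x\<close> and \<open>y\<close> if necessary, let \<open>m \<le> l\<close>, and put \<open>u = f\<^sup>-\<^sup>1\<close>. Two operators of first
  order annihilate \<open>u\<close>:
  \<open>P = l x \<partial>\<^sub>x + m y \<partial>\<^sub>y + l m\<close>, because \<open>f\<close> is quasi-homogeneous, and
  \<open>Q = l y\<^sup>l\<^sup>-\<^sup>1 \<partial>\<^sub>x - m x\<^sup>m\<^sup>-\<^sup>1 \<partial>\<^sub>y\<close>, because \<open>u\<close> is a function of \<open>f\<close>. Their symbols for the Bernstein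
  filtration have degrees \<open>2\<close> and \<open>l\<close> and form a regular sequence, so \<open>D / (D P + D Q)\<close> has
  multiplicity \<open>2 l\<close>; what has to be seen is that this module is \<open>K[x,y,f\<^sup>-\<^sup>1]\<close>.

  The proof makes this explicit by a basis. The space \<open>F\<^sub>k(D) u\<close> has as basis the standard monomials
  \<open>x\<^sup>a \<partial>\<^sub>y\<^sup>e y\<^sup>b u\<close> with \<open>e = 0\<close> or \<open>b < l\<close>, and \<open>\<partial>\<^sub>x\<^sup>c \<partial>\<^sub>y\<^sup>e y\<^sup>b u\<close> with \<open>c > 0\<close> and \<open>b < l - 1\<close>, of total
  degree at most \<open>k\<close>. Counting them gives a polynomial in \<open>k\<close> with leading term \<open>l k\<^sup>2\<close>
  (\<open>card_std_index\<close>). Three points carry the argument.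

  The standard monomials span, since rewriting by \<open>P\<close>, \<open>Q\<close> and \<open>f u = 1\<close> never raises the degree
  (\<open>mon_mem_std_span\<close>).

  They are linearly independent (\<open>std_independent\<close>). This is the delicate point: it depends on the
  exponent \<open>-1\<close> of \<open>f\<close>, and it cannot be read off from symbols, because different standard monomials
  of the same order can have proportional leading poles along \<open>f = 0\<close>. Without \<open>\<partial>\<^sub>x\<close> the pole order
  does decide (\<open>dy_sum_eq_0D\<close>). A relation that involves \<open>\<partial>\<^sub>x\<close> is multiplied by \<open>x\<close>: this lowers the
  order in \<open>\<partial>\<^sub>x\<close> by one, and it transforms the coefficients of the highest power of \<open>\<partial>\<^sub>x\<close> by a
  triangular map with diagonal entries \<open>m (b + 1) - l m - l c\<close>, which are nonzero because
  \<open>b + 1 < l\<close> (\<open>dy_comb_eq_0D\<close>).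

  The element \<open>u\<close> generates \<open>K[x,y,f\<^sup>-\<^sup>1]\<close> (\<open>ev_mult_u_power_mem\<close>), since the Euler operator
  multiplies \<open>x\<^sup>a y\<^sup>b u\<^sup>n\<^sup>+\<^sup>1\<close> by a nonzero scalar whenever \<open>a < m - 1\<close>, \<open>b < l - 1\<close> and \<open>n \<ge> 1\<close>, while the
  remaining \<open>x\<^sup>a y\<^sup>b u\<^sup>n\<^sup>+\<^sup>1\<close> are multiples of derivatives of \<open>u\<^sup>n\<close>.

  The multiplicity can be computed from this one good filtration because any two good filtrations
  contain each other up to a shift of the index (\<open>bernstein_multiplicityI\<close>).\<close>

section \<open>The Bernstein filtration of the Weyl algebra\<close>

lemma weyl_generator_relations:
  "weyl_y * weyl_x = weyl_x * (weyl_y :: 'k::field weyl)"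
  "weyl_dy * weyl_dx = weyl_dx * (weyl_dy :: 'k weyl)"
  "weyl_dx * weyl_x = weyl_x * weyl_dx + (1 :: 'k weyl)"
  "weyl_dy * weyl_y = weyl_y * weyl_dy + (1 :: 'k weyl)"
  "weyl_dx * weyl_y = weyl_y * (weyl_dx :: 'k weyl)"
  "weyl_dy * weyl_x = weyl_x * (weyl_dy :: 'k weyl)"
  by (transfer, blast intro: weyl_eq.intros)+

lemma weyl_const_commute: "p * weyl_const a = weyl_const a * (p :: 'k::field weyl)"
  by transfer (rule weyl_eq.const_central)

lemma weyl_const_of_nat: "weyl_const (of_nat n) = (of_nat n :: 'k::field weyl)"
  by (induction n) (simp_all add: weyl_const_simps)

lemma commute_power: "a * b = b * a \<Longrightarrow> a * b ^ n = b ^ n * (a :: 'a::monoid_mult)"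
  by (induction n) (simp_all, metis mult.assoc)

lemma heisenberg_power:
  fixes d t :: "'a::ring_1"
  assumes "d * t = t * d + 1"
  shows "d * t ^ n = t ^ n * d + of_nat n * t ^ (n - 1)"
proof (induction n)
  case (Suc n)
  have *: "of_nat n * (t ^ (n - 1) * t) = of_nat n * t ^ n"
    by (cases n) (simp_all add: power_commutes)
  have "d * t ^ Suc n = (d * t ^ n) * t"
    by (simp add: power_commutes mult.assoc)
  also have "\<dots> = t ^ n * (d * t) + of_nat n * (t ^ (n - 1) * t)"
    unfolding Suc by (simp add: Rings.distrib_right mult.assoc)
  also have "\<dots> = t ^ Suc n * d + of_nat (Suc n) * t ^ n"
    unfolding * assms by (simp add: algebra_simps power_commutes flip: mult.assoc)
  finally show ?case by simp
qed simp

definition weyl_monomial :: "nat \<Rightarrow> nat \<Rightarrow> nat \<Rightarrow> nat \<Rightarrow> 'k::field weyl" where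
  "weyl_monomial a b c e = weyl_x ^ a * weyl_y ^ b * weyl_dx ^ c * weyl_dy ^ e"

lemma bernstein_filtration_eq:
  "bernstein_filtration k =
     weyl.span {weyl_monomial a b c e | a b c e. int (a + b + c + e) \<le> k}"
  by (simp add: bernstein_filtration_def weyl_monomial_def)

lemma bernstein_filtration_mono: "i \<le> j \<Longrightarrow> bernstein_filtration i \<subseteq> bernstein_filtration j"
  unfolding bernstein_filtration_eq by (rule weyl.span_mono) force

lemma subspace_bernstein_filtration: "weyl.subspace (bernstein_filtration k)"
  unfolding bernstein_filtration_eq by (rule weyl.subspace_span)

lemma weyl_monomial_in_bernstein_filtration:
  "int (a + b + c + e) \<le> k \<Longrightarrow> weyl_monomial a b c e \<in> bernstein_filtration k"
  unfolding bernstein_filtration_eq by (rule weyl.span_base) blast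

lemma generator_mult_monomial:
  "weyl_x * weyl_monomial a b c e = (weyl_monomial (Suc a) b c e :: 'k::field weyl)"
  "weyl_y * weyl_monomial a b c e = (weyl_monomial a (Suc b) c e :: 'k weyl)"
  "weyl_dx * weyl_monomial a b c e =
     weyl_monomial a b (Suc c) e + weyl_scale (of_nat a) (weyl_monomial (a - 1) b c e :: 'k weyl)"
  "weyl_dy * weyl_monomial a b c e =
     weyl_monomial a b c (Suc e) + weyl_scale (of_nat b) (weyl_monomial a (b - 1) c e :: 'k weyl)"
proof -
  note rel = weyl_generator_relations
  have yx: "weyl_y * weyl_x ^ a = weyl_x ^ a * (weyl_y :: 'k weyl)"
    and dxy: "weyl_dx * weyl_y ^ b = weyl_y ^ b * (weyl_dx :: 'k weyl)"
    and dyx: "weyl_dy * weyl_x ^ a = weyl_x ^ a * (weyl_dy :: 'k weyl)"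
    and dydx: "weyl_dy * weyl_dx ^ c = weyl_dx ^ c * (weyl_dy :: 'k weyl)"
    by (simp_all add: commute_power rel)
  have dxx: "weyl_dx * (weyl_x ^ a * q) = weyl_x ^ a * (weyl_dx * q) + of_nat a * (weyl_x ^ (a - 1) * q)"
    for q :: "'k weyl"
    using arg_cong[OF heisenberg_power[OF rel(3), of a], of "\<lambda>t. t * q"]
    by (simp only: mult.assoc Rings.distrib_right)
  have dyy: "weyl_dy * (weyl_y ^ b * q) = weyl_y ^ b * (weyl_dy * q) + of_nat b * (weyl_y ^ (b - 1) * q)"
    for q :: "'k weyl"
    using arg_cong[OF heisenberg_power[OF rel(4), of b], of "\<lambda>t. t * q"]
    by (simp only: mult.assoc Rings.distrib_right)
  note move' = yx[THEN arg_cong[where f="\<lambda>t. t * _"], unfolded mult.assoc]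
    dxy[THEN arg_cong[where f="\<lambda>t. t * _"], unfolded mult.assoc]
    dyx[THEN arg_cong[where f="\<lambda>t. t * _"], unfolded mult.assoc]
    dydx[THEN arg_cong[where f="\<lambda>t. t * _"], unfolded mult.assoc]
    dxx dyy
  show "weyl_x * weyl_monomial a b c e = (weyl_monomial (Suc a) b c e :: 'k weyl)"
    by (simp add: weyl_monomial_def mult.assoc)
  show "weyl_y * weyl_monomial a b c e = (weyl_monomial a (Suc b) c e :: 'k weyl)"
    by (simp add: weyl_monomial_def mult.assoc move')
  show "weyl_dx * weyl_monomial a b c e =
     weyl_monomial a b (Suc c) e + weyl_scale (of_nat a) (weyl_monomial (a - 1) b c e :: 'k weyl)"
    by (simp add: weyl_monomial_def mult.assoc move' weyl_scale_def weyl_const_of_nat)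
  have "weyl_dy * weyl_monomial a b c e =
      weyl_x ^ a * (weyl_y ^ b * (weyl_dx ^ c * (weyl_dy * weyl_dy ^ e)))
      + weyl_x ^ a * (of_nat b * (weyl_y ^ (b - 1) * (weyl_dx ^ c * weyl_dy ^ e :: 'k weyl)))"
    by (simp add: weyl_monomial_def mult.assoc move' Rings.distrib_left)
  also have "weyl_x ^ a * (of_nat b * (weyl_y ^ (b - 1) * (weyl_dx ^ c * weyl_dy ^ e :: 'k weyl)))
      = of_nat b * (weyl_x ^ a * (weyl_y ^ (b - 1) * (weyl_dx ^ c * weyl_dy ^ e)))"
    by (metis mult.assoc weyl_const_commute weyl_const_of_nat)
  finally show "weyl_dy * weyl_monomial a b c e =
     weyl_monomial a b c (Suc e) + weyl_scale (of_nat b) (weyl_monomial a (b - 1) c e :: 'k weyl)"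
    by (simp add: weyl_monomial_def mult.assoc weyl_scale_def weyl_const_of_nat)
qed

lemma weyl_scale_mult:
  "p * weyl_scale a q = weyl_scale a (p * (q :: 'k::field weyl))"
  "weyl_scale a p * q = weyl_scale a (p * (q :: 'k::field weyl))"
  by (metis weyl_scale_def mult.assoc weyl_const_commute) (simp add: weyl_scale_def mult.assoc)

lemma generator_mult_bernstein_filtration:
  fixes p :: "'k::field weyl"
  assumes "g \<in> {weyl_x, weyl_y, weyl_dx, weyl_dy}" "p \<in> bernstein_filtration k"
  shows "g * p \<in> bernstein_filtration (k + 1)"
  using assms(2) unfolding bernstein_filtration_eq[of k]
proof (induction rule: weyl.span_induct_alt)
  case base
  then show ?case by (simp add: weyl.subspace_0 subspace_bernstein_filtration)
next
  case (step r p q)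
  then obtain a b c e where p: "p = weyl_monomial a b c e" "int (a + b + c + e) \<le> k" by blast
  have "weyl_monomial (a - 1) b c e \<in> bernstein_filtration (k + 1)"
    "weyl_monomial a (b - 1) c e \<in> bernstein_filtration (k + 1)"
    using p(2) by (intro weyl_monomial_in_bernstein_filtration; linarith)+
  then have "g * p \<in> bernstein_filtration (k + 1)"
    unfolding p(1) using assms(1) p(2)
    by (auto simp: generator_mult_monomial
        intro!: weyl.subspace_add[OF subspace_bernstein_filtration]
          weyl.subspace_scale[OF subspace_bernstein_filtration] weyl_monomial_in_bernstein_filtration)
  then have "weyl_scale r (g * p) + g * q \<in> bernstein_filtration (k + 1)"
    using step.IH
    by (intro weyl.subspace_add weyl.subspace_scale subspace_bernstein_filtration)
  then show ?case by (simp add: Rings.distrib_left weyl_scale_mult)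
qed

lemma generator_power_mult_bernstein_filtration:
  fixes p :: "'k::field weyl"
  assumes "g \<in> {weyl_x, weyl_y, weyl_dx, weyl_dy}" "p \<in> bernstein_filtration k"
  shows "g ^ n * p \<in> bernstein_filtration (k + int n)"
proof (induction n)
  case (Suc n)
  from generator_mult_bernstein_filtration[OF assms(1) this]
  show ?case by (simp add: mult.assoc algebra_simps)
qed (use assms in simp)

text \<open>Bringing a product into the order \<open>x, y, \<partial>\<^sub>x, \<partial>\<^sub>y\<close> by the Weyl relations only produces correction
  terms of smaller degree.\<close>

lemma bernstein_filtration_mult:
  fixes p q :: "'k::field weyl"
  assumes "p \<in> bernstein_filtration i" "q \<in> bernstein_filtration j"
  shows "p * q \<in> bernstein_filtration (i + j)"
  using assms(1) unfolding bernstein_filtration_eq[of i]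
proof (induction rule: weyl.span_induct_alt)
  case base
  then show ?case by (simp add: weyl.subspace_0 subspace_bernstein_filtration)
next
  case (step r p p')
  then obtain a b c e where p: "p = weyl_monomial a b c e" "int (a + b + c + e) \<le> i" by blast
  have "p * q \<in> bernstein_filtration (j + int e + int c + int b + int a)"
    unfolding p(1) weyl_monomial_def mult.assoc
    by (intro generator_power_mult_bernstein_filtration assms(2)) simp_all
  then have "p * q \<in> bernstein_filtration (i + j)"
    using bernstein_filtration_mono[of "j + int e + int c + int b + int a" "i + j"] p(2) by auto
  then have "weyl_scale r (p * q) + p' * q \<in> bernstein_filtration (i + j)"
    using step.IH
    by (intro weyl.subspace_add weyl.subspace_scale subspace_bernstein_filtration)
  then show ?case by (simp add: Rings.distrib_right weyl_scale_mult)
qed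

lemma generator_in_bernstein_filtration:
  "g \<in> {weyl_x, weyl_y, weyl_dx, weyl_dy} \<Longrightarrow> g \<in> (bernstein_filtration 1 :: 'k::field weyl set)"
  using weyl_monomial_in_bernstein_filtration[of 1 0 0 0 1]
    weyl_monomial_in_bernstein_filtration[of 0 1 0 0 1]
    weyl_monomial_in_bernstein_filtration[of 0 0 1 0 1]
    weyl_monomial_in_bernstein_filtration[of 0 0 0 1 1]
  by (auto simp: weyl_monomial_def)

lemma one_in_bernstein_filtration: "(1 :: 'k::field weyl) \<in> bernstein_filtration 0"
  using weyl_monomial_in_bernstein_filtration[of 0 0 0 0 0]
  by (simp add: weyl_monomial_def)

lemma weyl_const_in_bernstein_filtration: "weyl_const a \<in> bernstein_filtration 0"
  using weyl.subspace_scale[OF subspace_bernstein_filtration one_in_bernstein_filtration, of a]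
  by (simp add: weyl_scale_def)

lemma weyl_induct [case_names const generator add mult]:
  fixes p :: "'k::field weyl"
  assumes "\<And>a. P (weyl_const a)"
    and "\<And>g. g \<in> {weyl_x, weyl_y, weyl_dx, weyl_dy} \<Longrightarrow> P g"
    and "\<And>p q. P p \<Longrightarrow> P q \<Longrightarrow> P (p + q)" "\<And>p q. P p \<Longrightarrow> P q \<Longrightarrow> P (p * q)"
  shows "P p"
proof -
  define t where "t = rep_weyl p"
  have p: "p = abs_weyl t"
    unfolding t_def by (rule Quotient3_abs_rep[OF Quotient3_weyl, symmetric])
  show ?thesis unfolding p
    by (induction t) (use assms in \<open>auto simp flip: weyl_const.abs_eq weyl_x.abs_eq weyl_y.abs_eq
      weyl_dx.abs_eq weyl_dy.abs_eq plus_weyl.abs_eq times_weyl.abs_eq\<close>)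
qed

lemma bernstein_filtration_exhaustive: "\<exists>k. (p :: 'k::field weyl) \<in> bernstein_filtration k"
proof (induction p rule: weyl_induct)
  case (add p q)
  then obtain i j where "p \<in> bernstein_filtration i" "q \<in> bernstein_filtration j" by blast
  then have "p \<in> bernstein_filtration (max i j)" "q \<in> bernstein_filtration (max i j)"
    using bernstein_filtration_mono[of i "max i j"] bernstein_filtration_mono[of j "max i j"] by auto
  then show ?case using weyl.subspace_add[OF subspace_bernstein_filtration] by blast
qed (use bernstein_filtration_mult weyl_const_in_bernstein_filtration
    generator_in_bernstein_filtration in blast)+

lemma bernstein_filtration_finite_span:
  "\<exists>S. finite S \<and> bernstein_filtration k = (weyl.span S :: 'k::field weyl set)"
proof -
  have "{weyl_monomial a b c e | a b c e. int (a + b + c + e) \<le> k}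
      \<subseteq> (\<lambda>(a, b, c, e). weyl_monomial a b c e :: 'k weyl) `
          ({..nat k} \<times> {..nat k} \<times> {..nat k} \<times> {..nat k})"
    by (force simp: image_iff)
  then have "finite {weyl_monomial a b c e :: 'k weyl | a b c e. int (a + b + c + e) \<le> k}"
    by (rule finite_subset) simp
  then show ?thesis unfolding bernstein_filtration_eq by blast
qed

section \<open>Comparison of good filtrations\<close>

text \<open>The value of \<open>dim\<close> is meaningful only for subspaces with a finite basis, so monotonicity needs an
  ambient finitely generated space.\<close>

lemma (in vector_space) dim_mono_in_finite_span:
  assumes "A \<subseteq> B" "B \<subseteq> span S" "finite S"
  shows "dim A \<le> dim B"
proof -
  obtain T where T: "T \<subseteq> B" "independent T" "B \<subseteq> span T" "card T = dim B"
    using basis_exists by blast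
  then have "finite T"
    using independent_span_bound[of S T] assms by blast
  then show ?thesis using dim_le_card[of A T] assms T by auto
qed

context weyl_module
begin

lemma act_zero [simp]: "act 0 u = 0" "act p 0 = 0"
  using act_add_left[of 0 0 u] act_add_right[of p 0 0] by simp_all

lemma act_sum: "act (\<Sum>i\<in>I. P i) u = (\<Sum>i\<in>I. act (P i) u)"
    "act p (\<Sum>i\<in>I. v i) = (\<Sum>i\<in>I. act p (v i))"
  by (induction I rule: infinite_finite_induct) (simp_all add: act_add_left act_add_right)

lemma act_weyl_scale: "act (weyl_scale a p) u = scale a (act p u)"
  by (simp add: weyl_scale_def scale_def act_mult)

lemma act_in_span: "p \<in> weyl.span S \<Longrightarrow> act p u \<in> span ((\<lambda>q. act q u) ` S)"
  by (induction rule: weyl.span_induct_alt)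
    (simp_all add: act_add_left act_weyl_scale span_zero span_add span_scale span_base)

lemma good_filtration_finite_span:
  assumes "good_filtration N F"
  shows "\<exists>S. finite S \<and> F k \<subseteq> span S"
proof -
  obtain r :: nat and u s where F: "\<forall>k. F k = {\<Sum>i<r. act (P i) (u i) | P.
      \<forall>i<r. P i \<in> bernstein_filtration (k - s i)}"
    using assms unfolding good_filtration_def by (elim exE conjE) (rule that; assumption)
  have "\<forall>i. \<exists>S. finite S \<and> bernstein_filtration (k - s i) = (weyl.span S :: 'k weyl set)"
    by (blast intro: bernstein_filtration_finite_span)
  then obtain S where S: "\<And>i. finite (S i)"
      "\<And>i. bernstein_filtration (k - s i) = (weyl.span (S i) :: 'k weyl set)"
    by metis
  let ?T = "\<Union>i<r. (\<lambda>q. act q (u i)) ` S i"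
  have "(\<Sum>i<r. act (P i) (u i)) \<in> span ?T" if "\<forall>i<r. P i \<in> bernstein_filtration (k - s i)" for P
  proof (rule span_sum)
    fix i assume i: "i \<in> {..<r}"
    have "act (P i) (u i) \<in> span ((\<lambda>q. act q (u i)) ` S i)"
      using act_in_span S that i by auto
    moreover have "span ((\<lambda>q. act q (u i)) ` S i) \<subseteq> span ?T"
      by (rule span_mono) (use i in blast)
    ultimately show "act (P i) (u i) \<in> span ?T" by blast
  qed
  then have "F k \<subseteq> span ?T" unfolding F[rule_format] by blast
  moreover have "finite ?T" using S(1) by blast
  ultimately show ?thesis by blast
qed

text \<open>Each generator of one filtration is a combination of the generators of the other, and the finitely
  many coefficients that occur have bounded degree; the bound, corrected by the shifts in the two
  filtrations, is the constant \<open>c\<close>.\<close>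

lemma good_filtrations_comparable:
  assumes "good_filtration N F" "good_filtration N G"
  shows "\<exists>c\<ge>0. \<forall>k. F k \<subseteq> G (k + c)"
proof -
  obtain r :: nat and u s where NF: "N = {\<Sum>i<r. act (P i) (u i) | P. True}"
    and F: "\<forall>k. F k = {\<Sum>i<r. act (P i) (u i) | P. \<forall>i<r. P i \<in> bernstein_filtration (k - s i)}"
    using assms(1) unfolding good_filtration_def by (elim exE conjE) (rule that; assumption)
  obtain r' :: nat and v t where NG: "N = {\<Sum>i<r'. act (P i) (v i) | P. True}"
    and G: "\<forall>k. G k = {\<Sum>i<r'. act (P i) (v i) | P. \<forall>i<r'. P i \<in> bernstein_filtration (k - t i)}"
    using assms(2) unfolding good_filtration_def by (elim exE conjE) (rule that; assumption)
  have "\<exists>Q. u i = (\<Sum>j<r'. act (Q j) (v j))" if "i < r" for i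
  proof -
    have "(\<Sum>j<r. act (if j = i then 1 else 0) (u j)) = (\<Sum>j<r. if j = i then u j else 0)"
      by (rule sum.cong) (auto simp: act_one)
    also have "\<dots> = u i" using that by simp
    finally have "(\<Sum>j<r. act (if j = i then 1 else 0) (u j)) = u i" .
    then have "u i \<in> N" unfolding NF
      by (intro CollectI exI[of _ "\<lambda>j. if j = i then 1 else 0"]) simp
    then show ?thesis unfolding NG by blast
  qed
  then obtain Q where Q: "\<And>i. i < r \<Longrightarrow> u i = (\<Sum>j<r'. act (Q i j) (v j))" by metis
  define d where "d i j = (SOME k. Q i j \<in> bernstein_filtration k)" for i j
  have d: "Q i j \<in> bernstein_filtration (d i j)" for i j
    unfolding d_def by (rule someI_ex) (rule bernstein_filtration_exhaustive)
  \<comment> \<open>Any upper bound of all \<open>d i j - s i + t j\<close> will do; the sum of absolute values is one.\<close>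
  define c where "c = (\<Sum>i<r. \<Sum>j<r'. \<bar>d i j\<bar> + \<bar>s i\<bar> + \<bar>t j\<bar>)"
  have c: "d i j - s i + t j \<le> c" if "i < r" "j < r'" for i j
  proof -
    have "\<bar>d i j\<bar> + \<bar>s i\<bar> + \<bar>t j\<bar> \<le> (\<Sum>j<r'. \<bar>d i j\<bar> + \<bar>s i\<bar> + \<bar>t j\<bar>)"
      using that by (intro member_le_sum) auto
    also have "\<dots> \<le> c" unfolding c_def
      using that by (intro member_le_sum) (auto intro!: sum_nonneg)
    finally show ?thesis by linarith
  qed
  have "F k \<subseteq> G (k + c)" for k
  proof
    fix w assume "w \<in> F k"
    then obtain P where w: "w = (\<Sum>i<r. act (P i) (u i))"
      and P: "\<And>i. i < r \<Longrightarrow> P i \<in> bernstein_filtration (k - s i)" unfolding F[rule_format] by blast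
    have "w = (\<Sum>i<r. \<Sum>j<r'. act (P i * Q i j) (v j))"
      unfolding w by (rule sum.cong) (simp_all add: Q act_sum act_mult)
    also have "\<dots> = (\<Sum>j<r'. act (\<Sum>i<r. P i * Q i j) (v j))"
      by (subst sum.swap) (simp add: act_sum)
    finally have w: "w = (\<Sum>j<r'. act (\<Sum>i<r. P i * Q i j) (v j))" .
    have "(\<Sum>i<r. P i * Q i j) \<in> bernstein_filtration (k + c - t j)" if j: "j < r'" for j
    proof (rule weyl.subspace_sum[OF subspace_bernstein_filtration])
      fix i assume "i \<in> {..<r}"
      then have "i < r" by simp
      have "P i * Q i j \<in> bernstein_filtration (k - s i + d i j)"
        using P[OF \<open>i < r\<close>] d by (rule bernstein_filtration_mult)
      moreover have "k - s i + d i j \<le> k + c - t j" using c[OF \<open>i < r\<close> j] by linarith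
      ultimately show "P i * Q i j \<in> bernstein_filtration (k + c - t j)"
        using bernstein_filtration_mono by blast
    qed
    with w show "w \<in> G (k + c)" unfolding G[rule_format]
      by (intro CollectI exI[of _ "\<lambda>j. \<Sum>i<r. P i * Q i j"]) simp
  qed
  moreover have "c \<ge> 0" unfolding c_def by (intro sum_nonneg) simp
  ultimately show ?thesis by blast
qed

end

lemma lead_coeff_nonneg:
  fixes p :: "real poly"
  assumes "\<forall>\<^sub>F k :: int in at_top. poly p (of_int k) \<ge> 0"
  shows "lead_coeff p \<ge> 0"
proof (rule ccontr)
  assume "\<not> ?thesis"
  then have "lead_coeff (- p) > 0" by simp
  from poly_pinfty_gt_lc[OF this] obtain n where
    n: "\<And>x. x \<ge> n \<Longrightarrow> poly (- p) x \<ge> lead_coeff (- p)" by blast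
  obtain k0 where k0: "\<And>k. k \<ge> k0 \<Longrightarrow> poly p (of_int k) \<ge> 0"
    using assms unfolding eventually_at_top_linorder by blast
  define k where "k = max k0 \<lceil>n\<rceil>"
  have "of_int k \<ge> n" unfolding k_def by linarith
  from n[OF this] k0[of k] \<open>lead_coeff (- p) > 0\<close> show False
    by (simp add: k_def)
qed

lemma lead_coeff_shift:
  fixes q :: "real poly"
  shows "degree (q \<circ>\<^sub>p [:c, 1:]) = degree q" "lead_coeff (q \<circ>\<^sub>p [:c, 1:]) = lead_coeff q"
proof -
  show "degree (q \<circ>\<^sub>p [:c, 1:]) = degree q" by (simp add: degree_pcompose)
  show "lead_coeff (q \<circ>\<^sub>p [:c, 1:]) = lead_coeff q"
    using lead_coeff_comp[of "[:c, 1:]" q] by simp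
qed

text \<open>Hilbert polynomials take nonnegative values, and a shift of the argument does not change the leading
  term; so the inclusion of one filtration in a shift of another compares leading terms.\<close>

lemma degree_lead_coeff_le:
  fixes p q :: "real poly"
  assumes p: "\<forall>\<^sub>F k :: int in at_top. poly p (of_int k) \<ge> 0"
    and le: "\<forall>\<^sub>F k :: int in at_top. poly p (of_int k) \<le> poly q (of_int (k + c))"
  shows "degree p \<le> degree q" "degree p = degree q \<Longrightarrow> lead_coeff p \<le> lead_coeff q"
proof -
  define q' where "q' = q \<circ>\<^sub>p [:of_int c, 1:]"
  have q': "degree q' = degree q" "lead_coeff q' = lead_coeff q"
    unfolding q'_def by (rule lead_coeff_shift)+
  have "\<forall>\<^sub>F k :: int in at_top. poly (q' - p) (of_int k) \<ge> 0"
    using le by eventually_elim (simp add: q'_def poly_pcompose algebra_simps)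
  then have diff: "lead_coeff (q' - p) \<ge> 0" by (rule lead_coeff_nonneg)
  have p0: "lead_coeff p \<ge> 0" using p by (rule lead_coeff_nonneg)
  show deg: "degree p \<le> degree q"
  proof (rule ccontr)
    assume "\<not> ?thesis"
    then have lt: "degree q' < degree p" using q' by simp
    then have "lead_coeff (q' - p) = - lead_coeff p"
      using degree_add_eq_right[of q' "- p"] by (simp add: coeff_eq_0)
    with diff p0 have "lead_coeff p = 0" by linarith
    then show False using lt by simp
  qed
  show "lead_coeff p \<le> lead_coeff q" if eq: "degree p = degree q"
  proof (rule ccontr)
    assume *: "\<not> ?thesis"
    have co: "coeff (q' - p) (degree q) = lead_coeff q - lead_coeff p"
      using q' eq by simp
    moreover have "degree (q' - p) \<le> degree q" using degree_diff_le_max[of q' p] q' eq by simp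
    ultimately have "degree (q' - p) = degree q" using * le_degree[of "q' - p" "degree q"] by simp
    with co diff * show False by simp
  qed
qed

lemma (in weyl_module) bernstein_multiplicityI:
  assumes good: "good_filtration N F"
    and hilb: "\<forall>\<^sub>F k in at_top. real (dim (F k)) = poly p (of_int k)"
  shows "bernstein_multiplicity N = fact (degree p) * lead_coeff p"
  unfolding bernstein_multiplicity_def
proof (rule the_equality)
  show "\<exists>F' p'. good_filtration N F' \<and>
      (\<forall>\<^sub>F k in at_top. real (dim (F' k)) = poly p' (real_of_int k)) \<and>
      fact (degree p) * lead_coeff p = (fact (degree p') * lead_coeff p' :: real)"
    using assms by blast
next
  have compare: "(\<forall>\<^sub>F k :: int in at_top. poly p (of_int k) \<ge> 0) \<and>
     (\<exists>c. \<forall>\<^sub>F k :: int in at_top. poly p (of_int k) \<le> poly q (of_int (k + c)))"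
    if FG: "good_filtration N F" "good_filtration N G"
      "\<forall>\<^sub>F k in at_top. real (dim (F k)) = poly p (of_int k)"
      "\<forall>\<^sub>F k in at_top. real (dim (G k)) = poly q (of_int k)" for F G p q
  proof -
    have "\<forall>\<^sub>F k :: int in at_top. poly p (of_int k) \<ge> 0"
      using FG(3) by eventually_elim (metis of_nat_0_le_iff)
    obtain c where c: "c \<ge> 0" "\<And>k. F k \<subseteq> G (k + c)"
      using good_filtrations_comparable[OF FG(1,2)] by blast
    obtain k1 where "\<And>k. k \<ge> k1 \<Longrightarrow> real (dim (G k)) = poly q (of_int k)"
      using FG(4) unfolding eventually_at_top_linorder by blast
    then have "\<forall>\<^sub>F k in at_top. real (dim (G (k + c))) = poly q (of_int (k + c))"
      using c(1) unfolding eventually_at_top_linorder by (intro exI[of _ k1]) simp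
    with FG(3) have "\<forall>\<^sub>F k :: int in at_top. poly p (of_int k) \<le> poly q (of_int (k + c))"
    proof eventually_elim
      case (elim k)
      obtain S where "finite S" "G (k + c) \<subseteq> span S"
        using good_filtration_finite_span[OF FG(2)] by blast
      then have "dim (F k) \<le> dim (G (k + c))"
        using dim_mono_in_finite_span c(2) by blast
      with elim show ?case by (metis of_nat_le_iff)
    qed
    with \<open>\<forall>\<^sub>F k :: int in at_top. poly p (of_int k) \<ge> 0\<close> show ?thesis by blast
  qed
  fix e
  assume "\<exists>G q. good_filtration N G \<and>
      (\<forall>\<^sub>F k in at_top. real (dim (G k)) = poly q (real_of_int k)) \<and>
      e = fact (degree q) * lead_coeff q"
  then obtain G q where G: "good_filtration N G"
      "\<forall>\<^sub>F k in at_top. real (dim (G k)) = poly q (real_of_int k)"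
    and e: "e = fact (degree q) * lead_coeff q" by blast
  note pq = conjunct1[OF compare[OF good G(1) hilb G(2)]] conjunct2[OF compare[OF good G(1) hilb G(2)]]
    and qp = conjunct1[OF compare[OF G(1) good G(2) hilb]] conjunct2[OF compare[OF G(1) good G(2) hilb]]
  obtain c c' where c: "\<forall>\<^sub>F k :: int in at_top. poly p (of_int k) \<le> poly q (of_int (k + c))"
    and c': "\<forall>\<^sub>F k :: int in at_top. poly q (of_int k) \<le> poly p (of_int (k + c'))"
    using pq(2) qp(2) by blast
  note le = degree_lead_coeff_le[OF pq(1) c] and ge = degree_lead_coeff_le[OF qp(1) c']
  from le(1) ge(1) have "degree p = degree q" by simp
  with le(2) ge(2) e show "e = fact (degree p) * lead_coeff p" by simp
qed

section \<open>Differential operators applied to the reciprocal of \<open>x\<^sup>m + y\<^sup>l\<close>\<close>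

lemma self_add_eq_0D: "v = v + v \<Longrightarrow> v = (0 :: 'a::ab_group_add)"
  by simp

text \<open>The field of rational functions is replaced by a field that contains \<open>K[x,y]\<close> through \<open>ev\<close> and
  carries compatible derivations, and \<open>m \<le> l\<close> is assumed. The case \<open>l < m\<close> is then another instance, in
  which \<open>ev\<close> exchanges the two variables and \<open>Dx\<close> is the derivation with respect to \<open>y\<close>.\<close>

locale fermat_complement = vector_space scale
  for scale :: "'k::field_char_0 \<Rightarrow> 'a::field \<Rightarrow> 'a" +
  fixes ev :: "'k poly poly \<Rightarrow> 'a" and Dx Dy :: "'a \<Rightarrow> 'a" and l m :: nat
  assumes ev_add: "ev (p + q) = ev p + ev q"
    and ev_mult: "ev (p * q) = ev p * ev q"
    and ev_eq_0D: "ev p = 0 \<Longrightarrow> p = 0"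
    and scale_ev: "scale a v = ev [:[:a:]:] * v"
    and Dx_add: "Dx (v + w) = Dx v + Dx w" and Dx_mult: "Dx (v * w) = Dx v * w + v * Dx w"
    and Dy_add: "Dy (v + w) = Dy v + Dy w" and Dy_mult: "Dy (v * w) = Dy v * w + v * Dy w"
    and Dx_ev: "Dx (ev p) = ev (poly_dx p)" and Dy_ev: "Dy (ev p) = ev (poly_dy p)"
    and Dx_Dy: "Dx (Dy v) = Dy (Dx v)"
    and m_pos: "0 < m" and m_le_l: "m \<le> l"
begin

definition X where "X = ev poly_x"
definition Y where "Y = ev poly_y"
definition F where "F = poly_x ^ m + (poly_y :: 'k poly poly) ^ l"
definition u where "u = inverse (ev F)"

lemma l_pos: "0 < l" using m_pos m_le_l by simp

lemma ev_0 [simp]: "ev 0 = 0"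
  by (rule self_add_eq_0D[OF ev_add[of 0 0, unfolded add_0_right]])

lemma ev_1 [simp]: "ev 1 = 1"
proof -
  have "ev 1 * ev 1 = ev 1" by (simp flip: ev_mult)
  moreover have "ev 1 \<noteq> 0" using ev_eq_0D[of 1] by auto
  ultimately show ?thesis by simp
qed

lemma ev_minus: "ev (- p) = - ev p"
  using ev_add[of p "- p"] by (simp add: add_eq_0_iff)

lemma ev_diff: "ev (p - q) = ev p - ev q"
  using ev_add[of p "- q"] by (simp add: ev_minus)

lemma ev_power: "ev (p ^ n) = ev p ^ n"
  by (induction n) (simp_all add: ev_mult)

lemma ev_of_nat: "ev (of_nat n) = of_nat n"
  by (induction n) (simp_all add: ev_add)

lemma ev_sum: "ev (sum p I) = (\<Sum>i\<in>I. ev (p i))"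
  by (induction I rule: infinite_finite_induct) (simp_all add: ev_add)

lemma of_nat_mult_eq_scale: "of_nat n * v = scale (of_nat n) v"
  by (simp add: scale_ev flip: ev_of_nat) (simp add: of_nat_poly)

lemma scale_mult_right: "v * scale a w = scale a (v * w)"
  by (simp add: scale_ev)

lemma scale_mult_left: "scale a v * w = scale a (v * w)"
  by (simp add: scale_ev)

lemma Dx_0 [simp]: "Dx 0 = 0" and Dy_0 [simp]: "Dy 0 = 0"
  by (rule self_add_eq_0D[OF Dx_add[of 0 0, unfolded add_0_right]]
      self_add_eq_0D[OF Dy_add[of 0 0, unfolded add_0_right]])+

lemma Dx_scale: "Dx (scale a v) = scale a (Dx v)" and Dy_scale: "Dy (scale a v) = scale a (Dy v)"
  by (simp_all add: scale_ev Dx_mult Dy_mult Dx_ev Dy_ev)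

lemma Dx_of_nat: "Dx (of_nat n * v) = of_nat n * Dx v"
  and Dy_of_nat: "Dy (of_nat n * v) = of_nat n * Dy v"
  by (simp_all add: of_nat_mult_eq_scale Dx_scale Dy_scale)

lemma Dx_minus: "Dx (- v) = - Dx v" and Dy_minus: "Dy (- v) = - Dy v"
  using Dx_add[of v "- v"] Dy_add[of v "- v"] by (simp_all add: add_eq_0_iff)

lemma Dx_X [simp]: "Dx X = 1" and Dx_Y [simp]: "Dx Y = 0"
  and Dy_X [simp]: "Dy X = 0" and Dy_Y [simp]: "Dy Y = 1"
  by (simp_all add: X_def Y_def Dx_ev Dy_ev)

lemma Dx_1 [simp]: "Dx 1 = 0" and Dy_1 [simp]: "Dy 1 = 0"
  using Dx_ev[of 1] Dy_ev[of 1] by simp_all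

lemma Dx_power: "Dx (v ^ n) = of_nat n * v ^ (n - 1) * Dx v"
  and Dy_power: "Dy (v ^ n) = of_nat n * v ^ (n - 1) * Dy v"
proof -
  have *: "d * v ^ n + v * (of_nat n * v ^ (n - 1) * d) = of_nat (Suc n) * v ^ n * d" for n d
    by (cases n) (simp_all add: algebra_simps)
  show "Dx (v ^ n) = of_nat n * v ^ (n - 1) * Dx v"
  proof (induction n)
    case (Suc n)
    have "Dx (v ^ Suc n) = Dx v * v ^ n + v * (of_nat n * v ^ (n - 1) * Dx v)"
      by (simp add: Dx_mult Suc)
    then show ?case unfolding * by simp
  qed simp
  show "Dy (v ^ n) = of_nat n * v ^ (n - 1) * Dy v"
  proof (induction n)
    case (Suc n)
    have "Dy (v ^ Suc n) = Dy v * v ^ n + v * (of_nat n * v ^ (n - 1) * Dy v)"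
      by (simp add: Dy_mult Suc)
    then show ?case unfolding * by simp
  qed simp
qed

lemma degree_F: "degree F = l" and lead_coeff_F: "lead_coeff F = 1"
proof -
  have x: "(poly_x :: 'k poly poly) ^ m = [:[:0, 1:] ^ m:]"
    by (induction m) (simp_all add: poly_x_def one_pCons)
  have y: "(poly_y :: 'k poly poly) ^ l = monom 1 l"
    unfolding poly_y_def by (simp add: monom_altdef)
  have "degree ((poly_x :: 'k poly poly) ^ m) < degree ((poly_y :: 'k poly poly) ^ l)"
    unfolding x y using l_pos by (simp add: degree_monom_eq)
  then show "degree F = l" "lead_coeff F = 1"
    unfolding F_def y by (simp_all add: degree_add_eq_right degree_monom_eq coeff_eq_0)
qed

lemma ev_F: "ev F = X ^ m + Y ^ l"
  by (simp add: F_def X_def Y_def ev_add ev_power)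

lemma F_nonzero: "ev F \<noteq> 0"
  using lead_coeff_F ev_eq_0D[of F] by auto

lemma F_mult_u: "(X ^ m + Y ^ l) * u = 1"
  using F_nonzero by (simp add: u_def flip: ev_F)

lemma Dx_u: "Dx u = - of_nat m * X ^ (m - 1) * u ^ 2"
  and Dy_u: "Dy u = - of_nat l * Y ^ (l - 1) * u ^ 2"
proof -
  have u: "v = u * w" if "v * (X ^ m + Y ^ l) = w" for v w
    using that F_mult_u by (metis mult.assoc mult.commute mult_1)
  have "Dx ((X ^ m + Y ^ l) * u) = 0" "Dy ((X ^ m + Y ^ l) * u) = 0"
    by (simp_all add: F_mult_u)
  then have "Dx u * (X ^ m + Y ^ l) = - of_nat m * X ^ (m - 1) * u"
    "Dy u * (X ^ m + Y ^ l) = - of_nat l * Y ^ (l - 1) * u"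
    by (simp_all add: Dx_mult Dy_mult Dx_add Dy_add Dx_power Dy_power add_eq_0_iff mult.commute)
  from this[THEN u] show "Dx u = - of_nat m * X ^ (m - 1) * u ^ 2"
    "Dy u = - of_nat l * Y ^ (l - 1) * u ^ 2"
    by (simp_all add: power2_eq_square algebra_simps)
qed

text \<open>The vector field here is tangent to the level curves of \<open>f\<close>, so it annihilates every function of \<open>f\<close>.\<close>

lemma tangent_relation: "of_nat l * Y ^ (l - 1) * Dx u = of_nat m * X ^ (m - 1) * Dy u"
  by (simp add: Dx_u Dy_u)

lemma power_pred: "0 < n \<Longrightarrow> v * v ^ (n - 1) = (v :: 'a) ^ n"
  by (cases n) simp_all

lemma euler_relation: "of_nat l * X * Dx u + of_nat m * Y * Dy u = - of_nat l * of_nat m * u"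
proof -
  have "of_nat l * X * Dx u + of_nat m * Y * Dy u =
      - of_nat l * of_nat m * ((X * X ^ (m - 1) + Y * Y ^ (l - 1)) * u) * u"
    by (simp add: Dx_u Dy_u power2_eq_square algebra_simps)
  also have "\<dots> = - of_nat l * of_nat m * u"
    unfolding power_pred[OF m_pos] power_pred[OF l_pos] F_mult_u by simp
  finally show ?thesis .
qed

lemma Dx_pow_add: "(Dx ^^ n) (v + w) = (Dx ^^ n) v + (Dx ^^ n) w"
  and Dx_pow_minus: "(Dx ^^ n) (- v) = - (Dx ^^ n) v"
  and Dx_pow_scale: "(Dx ^^ n) (scale a v) = scale a ((Dx ^^ n) v)"
  and Dy_pow_add: "(Dy ^^ n) (v + w) = (Dy ^^ n) v + (Dy ^^ n) w"
  and Dy_pow_minus: "(Dy ^^ n) (- v) = - (Dy ^^ n) v"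
  and Dy_pow_scale: "(Dy ^^ n) (scale a v) = scale a ((Dy ^^ n) v)"
  and Dx_pow_0: "(Dx ^^ n) 0 = 0" and Dy_pow_0: "(Dy ^^ n) 0 = 0"
  by (induction n) (simp_all add: Dx_add Dy_add Dx_minus Dy_minus Dx_scale Dy_scale)

lemma Dx_pow_of_nat: "(Dx ^^ n) (of_nat j * v) = of_nat j * (Dx ^^ n) v"
  and Dy_pow_of_nat: "(Dy ^^ n) (of_nat j * v) = of_nat j * (Dy ^^ n) v"
  by (simp_all add: of_nat_mult_eq_scale Dx_pow_scale Dy_pow_scale)

lemma Dx_pow_diff: "(Dx ^^ n) (v - w) = (Dx ^^ n) v - (Dx ^^ n) w"
  and Dy_pow_diff: "(Dy ^^ n) (v - w) = (Dy ^^ n) v - (Dy ^^ n) w"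
  using Dx_pow_add[of n v "- w"] Dy_pow_add[of n v "- w"]
  by (simp_all add: Dx_pow_minus Dy_pow_minus)

lemma Dx_pow_sum: "(Dx ^^ n) (sum v I) = (\<Sum>i\<in>I. (Dx ^^ n) (v i))"
  and Dy_pow_sum: "(Dy ^^ n) (sum v I) = (\<Sum>i\<in>I. (Dy ^^ n) (v i))"
  by (induction I rule: infinite_finite_induct)
    (simp_all add: Dx_pow_add Dy_pow_add Dx_pow_0 Dy_pow_0)

lemma Dx_Dy_pow: "Dx ((Dy ^^ n) v) = (Dy ^^ n) (Dx v)"
  and Dy_Dx_pow: "Dy ((Dx ^^ n) v) = (Dx ^^ n) (Dy v)"
proof -
  show "Dx ((Dy ^^ n) v) = (Dy ^^ n) (Dx v)"
    by (induction n) (simp_all add: Dx_Dy)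
  show "Dy ((Dx ^^ n) v) = (Dx ^^ n) (Dy v)"
    by (induction n) (simp_all flip: Dx_Dy)
qed

lemma Dx_Y_mult: "Dx (Y * v) = Y * Dx v" and Dy_X_mult: "Dy (X * v) = X * Dy v"
  by (simp_all add: Dx_mult Dy_mult)

lemma Y_Dx_pow: "Y * (Dx ^^ n) v = (Dx ^^ n) (Y * v)"
  and X_Dy_pow: "X * (Dy ^^ n) v = (Dy ^^ n) (X * v)"
  by (induction n) (simp_all flip: Dx_Y_mult Dy_X_mult)

lemma Ypow_Dx: "Y ^ j * Dx v = Dx (Y ^ j * v)"
  by (simp add: Dx_mult Dx_power)

lemma Xpow_Dy_pow: "X ^ j * (Dy ^^ n) v = (Dy ^^ n) (X ^ j * v)"
  by (induction j) (simp_all add: mult.assoc X_Dy_pow)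

lemma X_Dx_pow: "X * (Dx ^^ n) v = (Dx ^^ n) (X * v) - of_nat n * (Dx ^^ (n - 1)) v"
  and Y_Dy_pow: "Y * (Dy ^^ n) v = (Dy ^^ n) (Y * v) - of_nat n * (Dy ^^ (n - 1)) v"
proof -
  have *: "(g ^^ n) v + (t * g ((g ^^ n) v) + of_nat n * g ((g ^^ (n - 1)) v))
      = t * g ((g ^^ n) v) + of_nat (Suc n) * (g ^^ n) v" for n t and g :: "'a \<Rightarrow> 'a"
    by (cases n) (simp_all add: algebra_simps)
  have "(Dx ^^ n) (X * v) = X * (Dx ^^ n) v + of_nat n * (Dx ^^ (n - 1)) v"
  proof (induction n)
    case (Suc n)
    have "(Dx ^^ Suc n) (X * v) = (Dx ^^ n) v + (X * Dx ((Dx ^^ n) v) + of_nat n * Dx ((Dx ^^ (n - 1)) v))"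
      by (simp add: Suc Dx_add Dx_mult[of X] Dx_of_nat)
    then show ?case unfolding * by simp
  qed simp
  then show "X * (Dx ^^ n) v = (Dx ^^ n) (X * v) - of_nat n * (Dx ^^ (n - 1)) v" by simp
  have "(Dy ^^ n) (Y * v) = Y * (Dy ^^ n) v + of_nat n * (Dy ^^ (n - 1)) v"
  proof (induction n)
    case (Suc n)
    have "(Dy ^^ Suc n) (Y * v) = (Dy ^^ n) v + (Y * Dy ((Dy ^^ n) v) + of_nat n * Dy ((Dy ^^ (n - 1)) v))"
      by (simp add: Suc Dy_add Dy_mult[of Y] Dy_of_nat)
    then show ?case unfolding * by simp
  qed simp
  then show "Y * (Dy ^^ n) v = (Dy ^^ n) (Y * v) - of_nat n * (Dy ^^ (n - 1)) v" by simp
qed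

text \<open>With \<open>y\<close> applied before \<open>\<partial>\<^sub>y\<close>, the relations below reduce the exponent of \<open>y\<close> without commuting it
  through powers of \<open>\<partial>\<^sub>y\<close>, and \<open>x\<close> acts on the \<open>\<partial>\<^sub>x\<close>-free part through a triangular map.\<close>

definition mon where "mon a b c e = X ^ a * (Dx ^^ c) ((Dy ^^ e) (Y ^ b * u))"

lemma X_mon: "X * mon a b c e = mon (Suc a) b c e"
  by (simp add: mon_def)

lemma Y_mon: "Y * mon a b c e = mon a (Suc b) c e - of_nat e * mon a b c (e - 1)"
proof -
  have "Y * mon a b c e = X ^ a * (Dx ^^ c) (Y * (Dy ^^ e) (Y ^ b * u))"
    by (simp add: mon_def Y_Dx_pow[symmetric])
  then show ?thesis
    by (simp add: mon_def Y_Dy_pow Dx_pow_diff Dx_pow_of_nat algebra_simps)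
qed

lemma Dx_mon: "Dx (mon a b c e) = mon a b (Suc c) e + of_nat a * mon (a - 1) b c e"
  by (simp add: mon_def Dx_mult Dx_power)

lemma Dy_mon: "Dy (mon a b c e) = mon a b c (Suc e)"
  by (simp add: mon_def Dy_mult Dy_power Dy_Dx_pow)

lemma euler_Dy_pow:
  "of_nat l * (X * Dx ((Dy ^^ e) (Y ^ b * u))) =
     of_nat m * (of_nat (Suc b) * (Dy ^^ e) (Y ^ b * u))
     - of_nat l * (of_nat m * (Dy ^^ e) (Y ^ b * u))
     - of_nat m * (Dy ^^ Suc e) (Y ^ Suc b * u)"
proof -
  have Yu: "Y ^ Suc b * Dy u = Dy (Y ^ Suc b * u) - of_nat (Suc b) * (Y ^ b * u)"
    by (simp add: Dy_mult[of "Y ^ Suc b"] Dy_power del: power_Suc)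
  have "of_nat l * (X * Dx ((Dy ^^ e) (Y ^ b * u)))
      = (Dy ^^ e) (of_nat l * (X * (Y ^ b * Dx u)))"
    by (simp only: Dx_Dy_pow X_Dy_pow Ypow_Dx Dy_pow_of_nat)
  also have "of_nat l * (X * (Y ^ b * Dx u)) = Y ^ b * (of_nat l * X * Dx u)"
    by (simp only: ac_simps)
  also have "of_nat l * X * Dx u = - of_nat l * of_nat m * u - of_nat m * Y * Dy u"
    using euler_relation by (simp add: algebra_simps)
  also have "Y ^ b * \<dots> = - (of_nat m * (Y ^ Suc b * Dy u)) - of_nat l * (of_nat m * (Y ^ b * u))"
    by (simp add: algebra_simps)
  also have "\<dots> = of_nat m * (of_nat (Suc b) * (Y ^ b * u)) - of_nat l * (of_nat m * (Y ^ b * u))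
      - of_nat m * Dy (Y ^ Suc b * u)"
    unfolding Yu by (simp add: algebra_simps)
  finally show ?thesis
    by (simp only: funpow_Suc_right o_apply Dy_pow_diff Dy_pow_of_nat)
qed

text \<open>The Euler relation as a rewriting rule for \<open>x \<partial>\<^sub>x\<close>. The terms with \<open>mon a b c e\<close> add up to the
  eigenvalue \<open>m (b + 1) - l m - l c\<close> on which linear independence rests. The equation is multiplied by \<open>l\<close> to avoid denominators.\<close>

lemma euler_mon:
  "of_nat l * mon (Suc a) b (Suc c) e = of_nat m * (of_nat (Suc b) * mon a b c e)
     - of_nat l * (of_nat m * mon a b c e) - of_nat l * (of_nat c * mon a b c e)
     - of_nat m * mon a (Suc b) c (Suc e)"
proof -
  define w where "w = (Dy ^^ e) (Y ^ b * u)"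
  have w: "of_nat l * (X * Dx w) = of_nat m * (of_nat (Suc b) * w) - of_nat l * (of_nat m * w)
      - of_nat m * (Dy ^^ Suc e) (Y ^ Suc b * u)"
    unfolding w_def by (rule euler_Dy_pow)
  have c: "of_nat c * (Dx ^^ (c - 1)) (Dx w) = of_nat c * (Dx ^^ c) w"
    by (cases c) (simp_all add: funpow_swap1)
  have "of_nat l * (X * (Dx ^^ Suc c) w) = of_nat l * (X * (Dx ^^ c) (Dx w))"
    by (simp add: funpow_swap1)
  also have "\<dots> = (Dx ^^ c) (of_nat l * (X * Dx w)) - of_nat l * (of_nat c * (Dx ^^ c) w)"
    by (simp only: X_Dx_pow c right_diff_distrib Dx_pow_of_nat)
  also have "(Dx ^^ c) (of_nat l * (X * Dx w)) = of_nat m * (of_nat (Suc b) * (Dx ^^ c) w)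
      - of_nat l * (of_nat m * (Dx ^^ c) w)
      - of_nat m * (Dx ^^ c) ((Dy ^^ Suc e) (Y ^ Suc b * u))"
    unfolding w by (simp only: Dx_pow_diff Dx_pow_of_nat)
  finally have "X ^ a * (of_nat l * (X * (Dx ^^ Suc c) w)) =
      X ^ a * (of_nat m * (of_nat (Suc b) * (Dx ^^ c) w) - of_nat l * (of_nat m * (Dx ^^ c) w)
      - of_nat m * (Dx ^^ c) ((Dy ^^ Suc e) (Y ^ Suc b * u)) - of_nat l * (of_nat c * (Dx ^^ c) w))"
    by (rule arg_cong)
  moreover have "of_nat l * mon (Suc a) b (Suc c) e = X ^ a * (of_nat l * (X * (Dx ^^ Suc c) w))"
    unfolding mon_def w_def power_Suc by (simp only: ac_simps)
  ultimately show ?thesis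
    by (simp only: mon_def w_def right_diff_distrib mult.left_commute[of "X ^ a"]) simp
qed

text \<open>The tangent relation as a rewriting rule for \<open>y\<^sup>l\<^sup>-\<^sup>1 \<partial>\<^sub>x\<close>. The right-hand side has lower order in
  \<open>\<partial>\<^sub>x\<close>, and its degree is not larger because \<open>m \<le> l\<close>.\<close>

lemma tangent_mon:
  "of_nat l * mon 0 (b + (l - 1)) (Suc c) e =
     of_nat m * (Dx ^^ c) (mon (m - 1) b 0 (Suc e) - of_nat b * mon (m - 1) (b - 1) 0 e)"
proof -
  have Yu: "Y ^ b * Dy u = Dy (Y ^ b * u) - of_nat b * (Y ^ (b - 1) * u)"
    by (simp add: Dy_mult[of "Y ^ b"] Dy_power)
  have "of_nat l * Dx ((Dy ^^ e) (Y ^ (b + (l - 1)) * u))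
      = (Dy ^^ e) (of_nat l * (Y ^ (b + (l - 1)) * Dx u))"
    by (simp only: Dx_Dy_pow Ypow_Dx Dy_pow_of_nat)
  also have "of_nat l * (Y ^ (b + (l - 1)) * Dx u) = Y ^ b * (of_nat l * Y ^ (l - 1) * Dx u)"
    by (simp only: power_add ac_simps)
  also have "Y ^ b * (of_nat l * Y ^ (l - 1) * Dx u) = of_nat m * (X ^ (m - 1) * (Y ^ b * Dy u))"
    unfolding tangent_relation by (simp add: algebra_simps)
  also have "\<dots> = of_nat m * (X ^ (m - 1) * (Dy (Y ^ b * u) - of_nat b * (Y ^ (b - 1) * u)))"
    unfolding Yu ..
  also have "(Dy ^^ e) \<dots> = of_nat m * (X ^ (m - 1) * ((Dy ^^ Suc e) (Y ^ b * u)
      - of_nat b * (Dy ^^ e) (Y ^ (b - 1) * u)))"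
    by (simp only: funpow_Suc_right o_apply Dy_pow_of_nat Xpow_Dy_pow[symmetric] Dy_pow_diff)
  finally have "of_nat l * Dx ((Dy ^^ e) (Y ^ (b + (l - 1)) * u)) =
     of_nat m * (mon (m - 1) b 0 (Suc e) - of_nat b * mon (m - 1) (b - 1) 0 e)"
    by (simp add: mon_def algebra_simps)
  then have "(Dx ^^ c) (of_nat l * Dx ((Dy ^^ e) (Y ^ (b + (l - 1)) * u))) =
     (Dx ^^ c) (of_nat m * (mon (m - 1) b 0 (Suc e) - of_nat b * mon (m - 1) (b - 1) 0 e))"
    by simp
  then show ?thesis
    unfolding Dx_pow_of_nat by (simp add: mon_def funpow_swap1)
qed

lemma Dy_pow_Y_pow: "\<exists>d :: nat. (Dy ^^ e) (Y ^ b) = of_nat d * Y ^ (b - e)"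
proof (induction e)
  case (Suc e)
  then obtain d where "(Dy ^^ e) (Y ^ b) = of_nat d * Y ^ (b - e)" by blast
  then have "(Dy ^^ Suc e) (Y ^ b) = of_nat (d * (b - e)) * Y ^ (b - Suc e)"
    by (simp add: Dy_of_nat Dy_power)
  then show ?case by blast
qed (auto intro: exI[of _ 1])

lemma Y_pow_eq_mon: "Y ^ b = mon m b 0 0 + mon 0 (b + l) 0 0"
proof -
  have "Y ^ b = Y ^ b * ((X ^ m + Y ^ l) * u)" by (simp add: F_mult_u)
  then show ?thesis by (simp add: mon_def power_add algebra_simps)
qed

text \<open>The relation \<open>y\<^sup>l u = 1 - x\<^sup>m u\<close> as a rewriting rule for \<open>y\<^sup>l\<close>. The derivatives of the polynomial
  \<open>y\<^sup>b\<close> that arise are scalar multiples of \<open>y\<^sup>b\<^sup>-\<^sup>e = f y\<^sup>b\<^sup>-\<^sup>e u\<close>, which gives monomials without derivatives.\<close>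

lemma curve_mon:
  "\<exists>d :: nat. mon a (b + l) 0 e = of_nat d * (mon (a + m) (b - e) 0 0 + mon a (b - e + l) 0 0) - mon (a + m) b 0 e"
proof -
  obtain d where d: "(Dy ^^ e) (Y ^ b) = of_nat d * Y ^ (b - e)" using Dy_pow_Y_pow by blast
  have "Y ^ (b + l) * u = Y ^ b * ((X ^ m + Y ^ l) * u) - X ^ m * (Y ^ b * u)"
    by (simp add: power_add algebra_simps)
  then have "(Dy ^^ e) (Y ^ (b + l) * u) = of_nat d * Y ^ (b - e) - X ^ m * (Dy ^^ e) (Y ^ b * u)"
    by (simp add: F_mult_u Dy_pow_diff d Xpow_Dy_pow)
  then have "mon a (b + l) 0 e = of_nat d * (X ^ a * Y ^ (b - e)) - mon (a + m) b 0 e"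
    unfolding mon_def by (simp add: power_add right_diff_distrib mult.assoc mult.left_commute)
  also have "X ^ a * Y ^ (b - e) = mon (a + m) (b - e) 0 0 + mon a (b - e + l) 0 0"
    by (subst Y_pow_eq_mon) (simp add: mon_def power_add algebra_simps)
  finally show ?thesis by blast
qed

section \<open>The standard monomials span\<close>

definition std where
  "std a b c e \<longleftrightarrow> (if c = 0 then e = 0 \<or> b < l else a = 0 \<and> Suc b < l)"

text \<open>The bound \<open>C\<close> on the order in \<open>\<partial>\<^sub>x\<close> is recorded besides the bound \<open>k\<close> on the degree, since the
  reduction to standard monomials is an induction on that order.\<close>

definition std_span where
  "std_span k C = span {mon a b c e | a b c e. std a b c e \<and> a + b + c + e \<le> k \<and> c \<le> C}"

lemma std_span_mono: "k \<le> k' \<Longrightarrow> C \<le> C' \<Longrightarrow> std_span k C \<subseteq> std_span k' C'"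
  unfolding std_span_def by (rule span_mono) force

lemma span_of_nat: "v \<in> span A \<Longrightarrow> of_nat n * v \<in> span A"
  by (simp add: of_nat_mult_eq_scale span_scale)

lemma span_of_nat_cancel:
  assumes "of_nat n * v \<in> span A" "0 < n"
  shows "v \<in> span A"
proof -
  have "scale (inverse (of_nat n)) (of_nat n * v) = v"
    using \<open>0 < n\<close> by (simp add: of_nat_mult_eq_scale)
  then show ?thesis using span_scale[OF assms(1), of "inverse (of_nat n)"] by simp
qed

lemma mon_mem_std_span_0: "a + b + e \<le> k \<Longrightarrow> mon a b 0 e \<in> std_span k 0"
proof (induction b arbitrary: a e rule: less_induct)
  case (less b)
  have base: "mon a b 0 e \<in> std_span k 0" if "e = 0 \<or> b < l" "a + b + e \<le> k" for a b e
    unfolding std_span_def by (rule span_base) (use that in \<open>force simp: std_def\<close>)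
  show ?case
  proof (cases "e = 0 \<or> b < l")
    case False
    define b' where "b' = b - l"
    have b: "b = b' + l" "b' < b" using False l_pos by (auto simp: b'_def)
    obtain d :: nat where d: "mon a b 0 e = of_nat d * (mon (a + m) (b' - e) 0 0 + mon a (b' - e + l) 0 0)
        - mon (a + m) b' 0 e"
      using curve_mon[of a b' e] unfolding b(1) by blast
    have "mon (a + m) (b' - e) 0 0 \<in> std_span k 0" "mon a (b' - e + l) 0 0 \<in> std_span k 0"
      using less.prems m_le_l b by (auto intro!: base)
    moreover have "mon (a + m) b' 0 e \<in> std_span k 0"
      by (rule less.IH) (use b m_le_l less.prems in auto)
    ultimately show ?thesis
      unfolding d std_span_def by (intro span_diff span_of_nat span_add)
  qed (use base less.prems in blast)
qed

lemma span_mapI: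
  assumes "v \<in> span A" "\<And>a. a \<in> A \<Longrightarrow> T a \<in> span B"
    and "\<And>v w. T (v + w) = T v + T w" "\<And>a v. T (scale a v) = scale a (T v)"
  shows "T v \<in> span B"
  using assms(1)
proof (induction rule: span_induct_alt)
  case base
  have "T 0 = 0" by (rule self_add_eq_0D[OF assms(3)[of 0 0, unfolded add_0_right]])
  then show ?case by (simp add: span_zero)
qed (simp add: assms span_add span_scale)

definition mon_span where
  "mon_span k C = span {mon a b c e | a b c e. a + b + c + e \<le> k \<and> c \<le> C}"

lemma Dx_mon_span: "v \<in> mon_span k C \<Longrightarrow> Dx v \<in> mon_span (Suc k) (Suc C)"
  unfolding mon_span_def
  by (erule span_mapI[where T = Dx])
    (force simp: Dx_add Dx_scale Dx_mon intro!: span_add span_of_nat intro: span_base)+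

lemma Dx_pow_mon_span: "v \<in> mon_span k C \<Longrightarrow> (Dx ^^ n) v \<in> mon_span (k + n) (C + n)"
  by (induction n) (simp_all add: Dx_mon_span)

lemma tangent_mon_mem_mon_span: "mon 0 (b + (l - 1)) (Suc c) e \<in> mon_span (m + b + e + c) c"
proof -
  have "mon (m - 1) b 0 (Suc e) \<in> mon_span (m + b + e) 0" "mon (m - 1) (b - 1) 0 e \<in> mon_span (m + b + e) 0"
    unfolding mon_span_def using m_pos by (intro span_base; force)+
  then have "mon (m - 1) b 0 (Suc e) - of_nat b * mon (m - 1) (b - 1) 0 e \<in> mon_span (m + b + e) 0"
    unfolding mon_span_def by (intro span_diff span_of_nat)
  from Dx_pow_mon_span[OF this, of c]
  have "of_nat l * mon 0 (b + (l - 1)) (Suc c) e \<in> mon_span (m + b + e + c) c"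
    unfolding tangent_mon mon_span_def by (intro span_of_nat) simp
  then show ?thesis unfolding mon_span_def by (rule span_of_nat_cancel) (rule l_pos)
qed

text \<open>A nonstandard monomial with \<open>c > 0\<close> contains \<open>x \<partial>\<^sub>x\<close> or \<open>y\<^sup>l\<^sup>-\<^sup>1 \<partial>\<^sub>x\<close>; in both cases the rewriting rule
  lowers the order in \<open>\<partial>\<^sub>x\<close> of every term and does not raise the degree.\<close>

lemma mon_mem_std_span: "a + b + c + e \<le> k \<Longrightarrow> mon a b c e \<in> std_span k c"
proof (induction c arbitrary: a b e k rule: less_induct)
  case (less c)
  show ?case
  proof (cases c)
    case 0
    then show ?thesis using mon_mem_std_span_0 less.prems by simp
  next
    case (Suc c')
    have mono: "v \<in> std_span k c" if "v \<in> std_span k c'" for v k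
      using std_span_mono[of k k c' c] that Suc by auto
    have IH: "mon a b c0 e \<in> std_span k c'" if "c0 \<le> c'" "a + b + c0 + e \<le> k" for a b c0 e k
      using less.IH[of c0 a b e k] std_span_mono[of k k c0 c'] that Suc by auto
    have mon_span: "mon_span k c' \<subseteq> std_span k c'" for k
    proof -
      have "subspace (std_span k c')" unfolding std_span_def by (rule subspace_span)
      then show ?thesis unfolding mon_span_def by (intro span_minimal) (use IH in auto)
    qed
    consider a' where "a = Suc a'" | "a = 0" "Suc b < l" | b' where "a = 0" "b = b' + (l - 1)"
    proof (cases a)
      case 0
      moreover have "b = (b - (l - 1)) + (l - 1)" if "\<not> Suc b < l" using that l_pos by simp
      ultimately show ?thesis using that(2,3) by blast
    qed (use that(1) in blast)
    then show ?thesis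
    proof cases
      case (1 a')
      have "of_nat l * mon a b c e \<in> std_span k c'"
        unfolding 1 Suc euler_mon
        using IH[of c' a' b e k] IH[of c' a' "Suc b" "Suc e" k] less.prems 1 Suc
        unfolding std_span_def by (intro span_diff span_of_nat) auto
      then show ?thesis using mono unfolding std_span_def using span_of_nat_cancel[OF _ l_pos] by blast
    next
      case 2
      then show ?thesis using less.prems Suc
        unfolding std_span_def by (intro span_base) (force simp: std_def)
    next
      case (3 b')
      have "mon 0 (b' + (l - 1)) (Suc c') e \<in> std_span (m + b' + e + c') c'"
        using tangent_mon_mem_mon_span mon_span by blast
      moreover have "m + b' + e + c' \<le> k" using less.prems 3 Suc m_le_l m_pos by linarith
      ultimately have "mon a b c e \<in> std_span k c'"
        using std_span_mono[of "m + b' + e + c'" k c' c'] 3 Suc by blast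
      then show ?thesis by (rule mono)
    qed
  qed
qed

end

section \<open>Pole orders of operators in \<open>\<partial>\<^sub>y\<close>\<close>

lemma dvd_mult_poly_y_power_cancel:
  fixes F :: "'k::field poly poly"
  assumes "poly F 0 \<noteq> 0" "F dvd p * poly_y ^ r"
  shows "F dvd p"
  using assms(2)
proof (induction r)
  case (Suc r)
  then obtain h where h: "(p * poly_y ^ r) * poly_y = F * h"
    by (auto simp: power_Suc2 mult.assoc simp del: power_Suc elim!: dvdE)
  have "poly F 0 * poly h 0 = poly (p * poly_y ^ r * poly_y) 0" unfolding h by simp
  also have "\<dots> = 0" by (simp add: poly_y_def)
  finally have "poly h 0 = 0" using assms(1) by simp
  then have "[:- 0, 1:] dvd h" by (simp only: poly_eq_0_iff_dvd)
  then obtain h' where h': "h = poly_y * h'" by (auto simp: poly_y_def elim: dvdE)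
  from h have "poly_y * (p * poly_y ^ r) = poly_y * (F * h')"
    unfolding h' by (simp only: ac_simps)
  moreover have "(poly_y :: 'k poly poly) \<noteq> 0" by (simp add: poly_y_def)
  ultimately have "p * poly_y ^ r = F * h'" by (metis mult_left_cancel)
  then show ?case using Suc.IH by (metis dvd_triv_left)
qed simp

context fermat_complement
begin

lemma ev_F_u: "ev F * u = 1"
  using F_mult_u by (simp add: ev_F)

lemma u_nonzero: "u \<noteq> 0"
  using ev_F_u by auto

lemma Dy_ev_u_power:
  "Dy (ev q * u ^ n) = ev (poly_dy q * F - of_nat (n * l) * (poly_y ^ (l - 1) * q)) * u ^ Suc n"
proof -
  have "of_nat n * u ^ (n - 1) * Dy u = - of_nat (n * l) * Y ^ (l - 1) * u ^ Suc n"
    by (cases n) (simp_all add: Dy_u power2_eq_square algebra_simps)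
  then have "Dy (ev q * u ^ n) = ev (poly_dy q) * (ev F * u) * u ^ n
      - of_nat (n * l) * (Y ^ (l - 1) * ev q) * u ^ Suc n"
    by (simp add: Dy_mult Dy_ev Dy_power ev_F_u)
  then show ?thesis
    by (simp add: ev_diff ev_mult ev_of_nat ev_power Y_def algebra_simps)
qed

text \<open>The leading pole of \<open>\<partial>\<^sub>y\<^sup>e (p u)\<close> is a nonzero multiple of \<open>p\<close> times the \<open>e\<close>-th power of \<open>\<partial>\<^sub>y f\<close>, which
  is a multiple of \<open>y\<^sup>l\<^sup>-\<^sup>1\<close>; the summand divisible by \<open>F\<close> has a pole of lower order.\<close>

lemma Dy_pow_symbol:
  "\<exists>h a. a \<noteq> 0 \<and>
     (Dy ^^ e) (ev p * u) = ev (h * F + [:[:a:]:] * (p * poly_y ^ ((l - 1) * e))) * u ^ Suc e"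
proof (induction e)
  case 0
  show ?case by (intro exI[of _ 0] exI[of _ 1]) (simp flip: one_pCons)
next
  case (Suc e)
  then obtain h a where a: "a \<noteq> 0"
    and h: "(Dy ^^ e) (ev p * u) = ev (h * F + [:[:a:]:] * (p * poly_y ^ ((l - 1) * e))) * u ^ Suc e"
    by blast
  define q where "q = h * F + [:[:a:]:] * (p * poly_y ^ ((l - 1) * e))"
  define N where "N = Suc e * l"
  have a': "[:[:- of_nat N * a:]:] = - of_nat N * [:[:a:]:]"
    by (simp add: of_nat_poly)
  have "poly_dy q * F - of_nat N * (poly_y ^ (l - 1) * q)
      = (poly_dy q - of_nat N * (poly_y ^ (l - 1) * h)) * F
        + [:[:- of_nat N * a:]:] * (p * poly_y ^ ((l - 1) * Suc e))"
    unfolding a' mult_Suc_right power_add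
    by (subst (2) q_def) (simp add: algebra_simps del: mult_pCons_left mult_pCons_right)
  then have "(Dy ^^ Suc e) (ev p * u) = ev ((poly_dy q - of_nat N * (poly_y ^ (l - 1) * h)) * F
        + [:[:- of_nat N * a:]:] * (p * poly_y ^ ((l - 1) * Suc e))) * u ^ Suc (Suc e)"
    using Dy_ev_u_power[of q "Suc e"] h by (simp only: q_def N_def funpow.simps o_apply)
  moreover have "- of_nat N * a \<noteq> 0" using a l_pos unfolding N_def
    by (metis mult_eq_0_iff mult_is_0 nat.distinct(1) neg_equal_0_iff_equal of_nat_eq_0_iff less_irrefl)
  ultimately show ?case by blast
qed

definition dy_sum where "dy_sum p E = (\<Sum>e\<le>E. (Dy ^^ e) (ev (p e) * u))"

lemma u_power_lift: "e \<le> E \<Longrightarrow> ev q * u ^ e = ev (q * F ^ (E - e)) * u ^ E"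
proof -
  assume "e \<le> E"
  have "ev (q * F ^ (E - e)) * u ^ E = ev q * (ev F * u) ^ (E - e) * u ^ e"
    using \<open>e \<le> E\<close> by (simp add: ev_mult ev_power power_mult_distrib flip: power_add)
  then show ?thesis by (simp add: ev_F_u)
qed

lemma dy_sum_eq_ev: "\<exists>q. dy_sum p E = ev q * u ^ Suc E"
proof -
  have "\<exists>q. (Dy ^^ e) (ev (p e) * u) = ev q * u ^ Suc E" if "e \<le> E" for e
  proof -
    obtain q where "(Dy ^^ e) (ev (p e) * u) = ev q * u ^ Suc e" using Dy_pow_symbol by blast
    then show ?thesis using u_power_lift[of "Suc e" "Suc E" q] that by auto
  qed
  then obtain q where q: "\<And>e. e \<le> E \<Longrightarrow> (Dy ^^ e) (ev (p e) * u) = ev (q e) * u ^ Suc E"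
    by metis
  have "dy_sum p E = (\<Sum>e\<le>E. ev (q e) * u ^ Suc E)"
    unfolding dy_sum_def by (rule sum.cong) (simp_all add: q del: power_Suc)
  then show ?thesis by (metis ev_sum sum_distrib_right)
qed

text \<open>The term with the most derivatives has the highest pole, so its leading part must be divisible by
  \<open>f\<close>. As \<open>f\<close> is prime to \<open>y\<close> and monic of degree \<open>l\<close> in \<open>y\<close>, a coefficient of smaller degree in \<open>y\<close> then
  vanishes.\<close>

lemma dy_sum_eq_0D:
  assumes "dy_sum p E = 0" "\<And>e. 0 < e \<Longrightarrow> degree (p e) < l" "e \<le> E"
  shows "p e = 0"
  using assms(1,3)
proof (induction E)
  case 0
  then have "ev (p 0) * u = 0" by (simp add: dy_sum_def)
  with 0 show ?case using u_nonzero ev_eq_0D by simp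
next
  case (Suc E)
  obtain q where q: "dy_sum p E = ev q * u ^ Suc E" using dy_sum_eq_ev by blast
  obtain h a where a: "a \<noteq> 0" and h: "(Dy ^^ Suc E) (ev (p (Suc E)) * u) =
      ev (h * F + [:[:a:]:] * (p (Suc E) * poly_y ^ ((l - 1) * Suc E))) * u ^ Suc (Suc E)"
    using Dy_pow_symbol by blast
  have "0 = dy_sum p E + (Dy ^^ Suc E) (ev (p (Suc E)) * u)" using Suc.prems by (simp add: dy_sum_def)
  also have "\<dots> = ev (q * F + (h * F + [:[:a:]:] * (p (Suc E) * poly_y ^ ((l - 1) * Suc E)))) * u ^ Suc (Suc E)"
    unfolding q h using u_power_lift[of "Suc E" "Suc (Suc E)" q]
    by (simp only: ev_add Rings.distrib_right) simp
  finally have "ev (q * F + (h * F + [:[:a:]:] * (p (Suc E) * poly_y ^ ((l - 1) * Suc E)))) = 0"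
    using u_nonzero by simp
  then have "q * F + (h * F + [:[:a:]:] * (p (Suc E) * poly_y ^ ((l - 1) * Suc E))) = 0"
    by (rule ev_eq_0D)
  then have "[:[:a:]:] * (p (Suc E) * poly_y ^ ((l - 1) * Suc E)) = F * (- q - h)"
    by (simp only: add.assoc[symmetric] add_eq_0_iff)
      (simp add: algebra_simps del: mult_pCons_left mult_pCons_right)
  then have "[:[:inverse a:]:] * ([:[:a:]:] * (p (Suc E) * poly_y ^ ((l - 1) * Suc E)))
      = [:[:inverse a:]:] * (F * (- q - h))" by (rule arg_cong)
  then have "[:[:inverse a:]:] * [:[:a:]:] * (p (Suc E) * poly_y ^ ((l - 1) * Suc E))
      = F * ([:[:inverse a:]:] * (- q - h))"
    by (simp only: mult.assoc mult.left_commute[of F])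
  moreover have "[:[:inverse a:]:] * [:[:a:]:] = 1" using a by (simp add: one_pCons)
  ultimately have "p (Suc E) * poly_y ^ ((l - 1) * Suc E) = F * ([:[:inverse a:]:] * (- q - h))"
    by (simp only: mult_1)
  then have "F dvd p (Suc E) * poly_y ^ ((l - 1) * Suc E)" by (rule dvdI)
  moreover have "poly F 0 \<noteq> 0"
    using l_pos by (simp add: F_def poly_x_def poly_y_def power_0_left)
  ultimately have "F dvd p (Suc E)" by (rule dvd_mult_poly_y_power_cancel[rotated])
  then have p: "p (Suc E) = 0"
    using dvd_imp_degree_le[of F "p (Suc E)"] assms(2)[of "Suc E"] by (force simp: degree_F)
  with Suc.prems have "dy_sum p E = 0" by (simp add: dy_sum_def Dy_pow_0)
  with Suc.IH Suc.prems p show ?case by (cases "e = Suc E") auto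
qed

lemma dy_sum_add: "dy_sum p E + dy_sum q E = dy_sum (\<lambda>e. p e + q e) E"
  by (simp add: dy_sum_def Dy_pow_add ev_add Rings.distrib_right sum.distrib)

lemma dy_sum_scale: "scale a (dy_sum p E) = dy_sum (\<lambda>e. [:[:a:]:] * p e) E"
proof -
  have "ev ([:[:a:]:] * q) * u = scale a (ev q * u)" for q
    by (simp add: scale_ev ev_mult del: mult_pCons_left)
  then show ?thesis by (simp add: dy_sum_def Dy_pow_scale scale_sum_right del: mult_pCons_left)
qed

lemma dy_sum_pad: "(\<And>e. E < e \<Longrightarrow> p e = 0) \<Longrightarrow> E \<le> E' \<Longrightarrow> dy_sum p E' = dy_sum p E"
  unfolding dy_sum_def by (rule sum.mono_neutral_right) (auto simp: Dy_pow_0)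

lemma X_dy_sum: "X * dy_sum p E = dy_sum (\<lambda>e. poly_x * p e) E"
  by (simp add: dy_sum_def sum_distrib_left X_Dy_pow ev_mult X_def[symmetric] mult.assoc)

section \<open>Linear independence of the standard monomials\<close>

definition order_span where "order_span C = span {mon a b c e | a b c e. c \<le> C}"

lemma mon_mem_order_span: "c \<le> C \<Longrightarrow> mon a b c e \<in> order_span C"
  unfolding order_span_def by (rule span_base) blast

lemma subspace_order_span: "subspace (order_span C)"
  unfolding order_span_def by (rule subspace_span)

text \<open>By the Euler relation every \<open>x\<close> cancels one \<open>\<partial>\<^sub>x\<close>.\<close>

lemma X_order_span:
  assumes "v \<in> order_span (Suc C)" shows "X * v \<in> order_span C"
  using assms unfolding order_span_def
proof (rule span_mapI[where T = "\<lambda>v. X * v"])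
  fix w assume "w \<in> {mon a b c e | a b c e. c \<le> Suc C}"
  then obtain a b c e where w: "w = mon a b c e" "c \<le> Suc C" by blast
  show "X * w \<in> span {mon a b c e | a b c e. c \<le> C}"
  proof (cases c)
    case 0
    then show ?thesis using mon_mem_order_span by (simp add: w X_mon order_span_def)
  next
    case (Suc c')
    then have "c' \<le> C" using w by simp
    then have "of_nat l * mon (Suc a) b (Suc c') e \<in> span {mon a b c e | a b c e. c \<le> C}"
      unfolding euler_mon using mon_mem_order_span unfolding order_span_def by (intro span_diff span_of_nat) auto
    then show ?thesis using span_of_nat_cancel[OF _ l_pos] by (simp add: w X_mon Suc)
  qed
qed (simp_all add: Rings.distrib_left scale_mult_right)

lemma tangent_mon_mem_order_span:
  assumes "l \<le> Suc b" shows "mon 0 b (Suc c) e \<in> order_span c"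
proof -
  obtain b' where "b = b' + (l - 1)"
    using assms by (metis add.commute le_Suc_ex le_diff_conv Suc_eq_plus1)
  moreover have "mon_span k c \<subseteq> order_span c" for k unfolding mon_span_def order_span_def by (rule span_mono) blast
  ultimately show ?thesis using tangent_mon_mem_mon_span[of b' c e] by blast
qed

definition y_reduced where
  "y_reduced p E \<longleftrightarrow> (\<forall>e>0. degree (p e :: 'k poly poly) < l) \<and> (\<forall>e>E. p e = 0)"

lemma order_span_0_eq_dy_sum:
  assumes "v \<in> order_span 0"
  shows "\<exists>p E. v = dy_sum p E \<and> y_reduced p E"
proof -
  let ?T = "{dy_sum p E | p E. y_reduced p E}"
  have add: "dy_sum p E + dy_sum q E' \<in> ?T" if "y_reduced p E" "y_reduced q E'" for p q E E'
  proof -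
    have "dy_sum p E = dy_sum p (max E E')" "dy_sum q E' = dy_sum q (max E E')"
      using that by (auto simp: y_reduced_def intro!: dy_sum_pad[symmetric])
    then have "dy_sum p E + dy_sum q E' = dy_sum (\<lambda>e. p e + q e) (max E E')" by (simp add: dy_sum_add)
    moreover have "y_reduced (\<lambda>e. p e + q e) (max E E')"
      using that by (simp add: y_reduced_def degree_add_less)
    ultimately show ?thesis by blast
  qed
  have scale: "scale a (dy_sum p E) \<in> ?T" if "y_reduced p E" for a p E
  proof -
    have "degree ([:[:a:]:] * p e) \<le> degree (p e)" for e
      using degree_mult_le[of "[:[:a:]:]" "p e"] by simp
    then have "y_reduced (\<lambda>e. [:[:a:]:] * p e) E"
      using that unfolding y_reduced_def by (metis le_less_trans mult_zero_right)
    then show ?thesis unfolding dy_sum_scale by blast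
  qed
  have mon: "mon a b 0 e \<in> ?T" if "e = 0 \<or> b < l" for a b e
  proof -
    define q :: "'k poly poly" where "q = poly_x ^ a * poly_y ^ b"
    define p where "p e' = (if e' = e then q else 0)" for e'
    have "degree q \<le> b"
      using degree_mult_le[of "(poly_x :: 'k poly poly) ^ a" "poly_y ^ b"]
        degree_power_le[of "poly_x :: 'k poly poly" a] degree_power_le[of "poly_y :: 'k poly poly" b]
      by (simp add: poly_x_def poly_y_def q_def)
    then have "y_reduced p e" using that l_pos by (auto simp: y_reduced_def p_def)
    moreover have "dy_sum p e = mon a b 0 e"
    proof -
      have "dy_sum p e = (\<Sum>e'\<le>e. if e' = e then (Dy ^^ e) (ev q * u) else 0)"
        unfolding dy_sum_def by (rule sum.cong) (simp_all add: Dy_pow_0 p_def)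
      also have "\<dots> = (Dy ^^ e) (X ^ a * (Y ^ b * u))"
        by (simp add: q_def ev_mult ev_power X_def Y_def mult.assoc)
      finally show ?thesis by (simp add: mon_def Xpow_Dy_pow)
    qed
    ultimately have "mon a b 0 e = dy_sum p e \<and> y_reduced p e" by simp
    then show ?thesis by blast
  qed
  have T: "subspace ?T"
  proof (rule subspaceI)
    have "y_reduced (\<lambda>_. 0) 0" using l_pos by (simp add: y_reduced_def)
    moreover have "dy_sum (\<lambda>_. 0) 0 = 0" by (simp add: dy_sum_def)
    ultimately show "0 \<in> ?T" by force
  qed (use add scale in blast)+
  have "mon a b 0 e \<in> ?T" for a b e
  proof -
    have "mon a b 0 e \<in> std_span (a + b + e) 0" by (rule mon_mem_std_span_0) simp
    also have "std_span (a + b + e) 0 \<subseteq> ?T" unfolding std_span_def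
      by (rule span_minimal[OF _ T]) (use mon in \<open>force simp: std_def\<close>)
    finally show ?thesis .
  qed
  then have "order_span 0 \<subseteq> ?T" unfolding order_span_def by (intro span_minimal T) blast
  with assms show ?thesis by blast
qed

text \<open>The coefficient of a power of \<open>\<partial>\<^sub>x\<close> in a combination of standard monomials. The sum runs over
  \<open>b < l\<close> instead of \<open>b < l - 1\<close>, so that multiplication by \<open>x\<close>, which can raise \<open>b\<close> by one, leads to a sum
  of the same shape.\<close>

definition dy_comb where
  "dy_comb g E = (\<Sum>e\<le>E. \<Sum>b<l. scale (g b e) (mon 0 b 0 e))"

lemma dy_comb_eq_dy_sum: "dy_comb g E = dy_sum (\<lambda>e. \<Sum>b<l. monom [:g b e:] b) E"
proof -
  have "ev (monom [:a:] b) = scale a (Y ^ b)" for a b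
  proof -
    have "monom [:a:] b = [:[:a:]:] * poly_y ^ b" by (simp add: poly_y_def monom_altdef)
    then show ?thesis by (simp only: scale_ev Y_def ev_mult ev_power)
  qed
  then show ?thesis
    unfolding dy_comb_def dy_sum_def
    by (simp add: mon_def ev_sum sum_distrib_right Dy_pow_sum scale_mult_left Dy_pow_scale)
qed

lemma Dx_pow_dy_comb: "(Dx ^^ c) (dy_comb g E) = (\<Sum>e\<le>E. \<Sum>b<l. scale (g b e) (mon 0 b c e))"
  by (simp add: dy_comb_def Dx_pow_sum Dx_pow_scale mon_def)

text \<open>The action of \<open>l x \<partial>\<^sub>x\<^sup>c\<^sup>+\<^sup>1\<close> on coefficients, as given by the Euler relation.\<close>

definition euler_coeff :: "nat \<Rightarrow> (nat \<Rightarrow> nat \<Rightarrow> 'k) \<Rightarrow> nat \<Rightarrow> nat \<Rightarrow> 'k" where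
  "euler_coeff c g b e = (of_nat m * of_nat (Suc b) - of_nat l * of_nat m - of_nat l * of_nat c) * g b e
     - (if b = 0 \<or> e = 0 then 0 else of_nat m * g (b - 1) (e - 1))"

lemma X_Dx_pow_dy_comb:
  assumes g: "\<And>b e. g b e \<noteq> 0 \<Longrightarrow> Suc b < l \<and> e \<le> E"
  shows "of_nat l * (X * (Dx ^^ Suc c) (dy_comb g E)) = (Dx ^^ c) (dy_comb (euler_coeff c g) (Suc E))"
proof -
  define A where "A b = (of_nat m * of_nat (Suc b) - of_nat l * of_nat m - of_nat l * of_nat c :: 'k)" for b
  have step: "of_nat l * (X * scale a (mon 0 b (Suc c) e))
      = scale (A b * a) (mon 0 b c e) - scale (of_nat m * a) (mon 0 (Suc b) c (Suc e))" for a b e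
  proof -
    have "of_nat l * (X * scale a (mon 0 b (Suc c) e)) = scale a (of_nat l * mon 1 b (Suc c) e)"
      by (simp add: scale_mult_right X_mon)
    also have "\<dots> = scale (A b * a) (mon 0 b c e) - scale (of_nat m * a) (mon 0 (Suc b) c (Suc e))"
      unfolding One_nat_def euler_mon
      by (simp only: of_nat_mult_eq_scale scale_right_diff_distrib scale_left_diff_distrib
          scale_scale A_def left_diff_distrib right_diff_distrib ac_simps)
    finally show ?thesis .
  qed
  have "of_nat l * (X * (Dx ^^ Suc c) (dy_comb g E)) =
      (\<Sum>e\<le>E. \<Sum>b<l. scale (A b * g b e) (mon 0 b c e))
      - (\<Sum>e\<le>E. \<Sum>b<l. scale (of_nat m * g b e) (mon 0 (Suc b) c (Suc e)))"
    unfolding Dx_pow_dy_comb sum_distrib_left step sum_subtractf ..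
  also have "(\<Sum>e\<le>E. \<Sum>b<l. scale (A b * g b e) (mon 0 b c e))
      = (\<Sum>e\<le>Suc E. \<Sum>b<l. scale (A b * g b e) (mon 0 b c e))"
    using g[of _ "Suc E"] by (simp, intro sum.neutral) force
  also have "(\<Sum>e\<le>E. \<Sum>b<l. scale (of_nat m * g b e) (mon 0 (Suc b) c (Suc e)))
      = (\<Sum>e\<le>Suc E. \<Sum>b<l. scale (if b = 0 \<or> e = 0 then 0 else of_nat m * g (b - 1) (e - 1)) (mon 0 b c e))"
  proof -
    obtain l' where l': "l = Suc l'" using l_pos gr0_implies_Suc by blast
    have "(\<Sum>b<l. scale (of_nat m * g b e) (mon 0 (Suc b) c (Suc e)))
        = (\<Sum>b<l'. scale (of_nat m * g b e) (mon 0 (Suc b) c (Suc e)))" for e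
      using g[of l' e] by (auto simp: l')
    moreover have "(\<Sum>b<l. scale (if b = 0 \<or> Suc e = 0 then 0 else of_nat m * g (b - 1) (Suc e - 1)) (mon 0 b c (Suc e)))
        = (\<Sum>b<l'. scale (of_nat m * g b e) (mon 0 (Suc b) c (Suc e)))" for e
      unfolding l' sum.lessThan_Suc_shift by simp
    ultimately show ?thesis by (simp add: sum.atMost_Suc_shift del: sum.atMost_Suc)
  qed
  finally show ?thesis
    unfolding Dx_pow_dy_comb euler_coeff_def A_def by (simp only: scale_left_diff_distrib sum_subtractf)
qed

text \<open>The off-diagonal part of \<open>euler_coeff\<close> involves only coefficients with smaller \<open>e\<close>, so induction on
  \<open>e\<close> reduces the claim to the diagonal entries. These are nonzero by \<open>m (b + 1) < m l\<close>; it is here that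
  the exponent \<open>-1\<close> of \<open>f\<close> enters, since for another exponent \<open>s\<close> the term \<open>- l m\<close> would be \<open>s l m\<close>.\<close>

lemma euler_coeff_eq_0D:
  assumes "\<And>b e. Suc b < l \<Longrightarrow> euler_coeff c g b e = 0" "\<And>b e. g b e \<noteq> 0 \<Longrightarrow> Suc b < l"
  shows "g b e = 0"
proof -
  have eigenvalue: "of_nat m * of_nat (Suc b) - of_nat l * of_nat m - of_nat l * of_nat c \<noteq> (0 :: 'k)"
    if "Suc b < l" for b
  proof
    assume "of_nat m * of_nat (Suc b) - of_nat l * of_nat m - of_nat l * of_nat c = (0 :: 'k)"
    then have "of_nat (m * Suc b) = (of_nat (l * m + l * c) :: 'k)"
      by (simp add: algebra_simps)
    then have "m * Suc b = l * m + l * c" by (simp only: of_nat_eq_iff)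
    moreover have "m * Suc b < m * l" using that m_pos by (simp only: mult_less_cancel1)
    ultimately show False by (simp add: mult.commute)
  qed
  show ?thesis
  proof (induction e arbitrary: b)
    case 0
    show ?case
    proof (rule ccontr)
      assume "g b 0 \<noteq> 0"
      then have "Suc b < l" by (rule assms(2))
      then show False using assms(1)[of b 0] eigenvalue[of b] \<open>g b 0 \<noteq> 0\<close>
        by (simp add: euler_coeff_def)
    qed
  next
    case (Suc e)
    show ?case
    proof (rule ccontr)
      assume "g b (Suc e) \<noteq> 0"
      then have "Suc b < l" by (rule assms(2))
      then show False using assms(1)[of b "Suc e"] eigenvalue[of b] \<open>g b (Suc e) \<noteq> 0\<close>
        by (cases "b = 0") (simp_all add: euler_coeff_def Suc)
    qed
  qed
qed

lemma euler_coeff_outside: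
  assumes "\<And>b e. g b e \<noteq> 0 \<Longrightarrow> Suc b < l \<and> e \<le> E" "Suc E < e"
  shows "euler_coeff c g b e = 0"
proof -
  have "\<not> e \<le> E" "\<not> e - 1 \<le> E" using assms(2) by auto
  then have "g b e = 0" "g (b - 1) (e - 1) = 0" using assms(1) by blast+
  then show ?thesis by (simp add: euler_coeff_def)
qed

text \<open>Multiplication by \<open>x\<close> turns a relation of order \<open>c + 1\<close> in \<open>\<partial>\<^sub>x\<close> into one of order \<open>c\<close> whose highest
  coefficients are \<open>euler_coeff c g\<close>. For \<open>c > 0\<close> those with \<open>b + 1 = l\<close> belong to monomials of lower order
  by the tangent relation, and the others vanish by induction. For \<open>c = 0\<close> the remaining terms are
  divisible by \<open>x\<close> whereas the coefficients are constant in \<open>x\<close>, so that the independence of operators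
  in \<open>\<partial>\<^sub>y\<close> applies.\<close>

lemma dy_comb_eq_0D:
  assumes "\<And>b e. g b e \<noteq> 0 \<Longrightarrow> Suc b < l \<and> e \<le> E" "(Dx ^^ Suc c) (dy_comb g E) \<in> order_span c"
  shows "g b e = 0"
  using assms
proof (induction c arbitrary: g E b e)
  case 0
  note g = "0.prems"(1)
  obtain p E' where p: "(Dx ^^ Suc 0) (dy_comb g E) = dy_sum p E'" "y_reduced p E'"
    using order_span_0_eq_dy_sum[OF "0.prems"(2)] by blast
  define h where "h = euler_coeff 0 g"
  \<comment> \<open>The relation \<open>- l x (\<partial>\<^sub>x w) + l x (\<partial>\<^sub>x w) = 0\<close> for \<open>w = dy_comb g E\<close>, expanded in two ways.\<close>
  define q where "q e = (\<Sum>b<l. monom [:h b e:] b)" for e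
  define E'' where "E'' = max (Suc E) E'"
  have h_0: "h b e = 0" if "Suc E < e" for b e
    unfolding h_def by (rule euler_coeff_outside[OF g that])
  have q: "coeff (q e) b = (if b < l then [:h b e:] else 0)" for b e
    by (simp add: q_def coeff_sum)
  have deg: "degree (- [:[:of_nat l:]:] * (poly_x * p e) + q e) < l" if "0 < e" for e
  proof (rule degree_add_less)
    have "degree (p e) < l" using p(2) that by (simp add: y_reduced_def)
    moreover have "degree (- [:[:of_nat l:]:] * (poly_x * p e)) \<le> degree (p e)"
      using degree_mult_le[of "- [:[:of_nat l:]:] * poly_x" "p e"]
      by (simp add: poly_x_def mult.assoc)
    ultimately show "degree (- [:[:of_nat l:]:] * (poly_x * p e)) < l" by simp
    show "degree (q e) < l"
      using l_pos by (intro degree_lessI) (auto simp: q)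
  qed
  have "dy_sum (\<lambda>e. - [:[:of_nat l:]:] * (poly_x * p e) + q e) E'' =
      scale (- of_nat l) (X * dy_sum p E'') + dy_sum q E''"
    by (simp add: X_dy_sum dy_sum_scale dy_sum_add del: mult_pCons_left)
  also have "dy_sum p E'' = dy_sum p E'"
    using p(2) by (intro dy_sum_pad) (auto simp: y_reduced_def E''_def)
  also have "dy_sum q E'' = dy_sum q (Suc E)"
    by (intro dy_sum_pad) (auto simp: q_def h_0 E''_def)
  also have "dy_sum q (Suc E) = dy_comb (euler_coeff 0 g) (Suc E)"
    unfolding dy_comb_eq_dy_sum q_def h_def ..
  also have "\<dots> = of_nat l * (X * (Dx ^^ Suc 0) (dy_comb g E))"
    using X_Dx_pow_dy_comb[of g E 0, OF g] by simp
  also have "scale (- of_nat l) (X * dy_sum p E') + of_nat l * (X * (Dx ^^ Suc 0) (dy_comb g E)) = 0"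
    unfolding p(1) of_nat_mult_eq_scale by (simp add: scale_minus_left)
  finally have "dy_sum (\<lambda>e. - [:[:of_nat l:]:] * (poly_x * p e) + q e) E'' = 0" .
  from dy_sum_eq_0D[OF this deg] have eq: "- [:[:of_nat l:]:] * (poly_x * p e) + q e = 0" if "e \<le> E''" for e
    using that by blast
  have "euler_coeff 0 g b e = 0" if "Suc b < l" for b e
  proof (cases "e \<le> Suc E")
    case True
    then have "coeff (- [:[:of_nat l:]:] * (poly_x * p e) + q e) b = 0"
      using eq[of e] by (simp add: E''_def)
    then have "coeff (coeff (- [:[:of_nat l:]:] * (poly_x * p e) + q e) b) 0 = 0" by simp
    then show ?thesis using that by (simp add: q poly_x_def h_def)
  next
    case False
    then show ?thesis using h_0 by (simp add: h_def)
  qed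
  then show ?case by (rule euler_coeff_eq_0D) (use g in blast)+
next
  case (Suc c)
  note g = Suc.prems(1)
  define h where "h = euler_coeff (Suc c) g"
  \<comment> \<open>\<open>h'\<close> drops the coefficients with \<open>b + 1 = l\<close>, whose monomials have lower order.\<close>
  define h' where "h' b e = (if Suc b < l \<and> e \<le> Suc E then h b e else 0)" for b e
  have h_0: "h b e = 0" if "Suc E < e" for b e
    unfolding h_def by (rule euler_coeff_outside[OF g that])
  have "X * (Dx ^^ Suc (Suc c)) (dy_comb g E) \<in> order_span c" by (rule X_order_span) (rule Suc.prems(2))
  then have "of_nat l * (X * (Dx ^^ Suc (Suc c)) (dy_comb g E)) \<in> order_span c"
    unfolding order_span_def by (rule span_of_nat)
  then have h_order_span: "(Dx ^^ Suc c) (dy_comb h (Suc E)) \<in> order_span c"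
    unfolding h_def by (subst X_Dx_pow_dy_comb[symmetric]) (use g in blast)+
  have "(Dx ^^ Suc c) (dy_comb h (Suc E)) - (Dx ^^ Suc c) (dy_comb h' (Suc E))
      = (\<Sum>e\<le>Suc E. \<Sum>b<l. scale (h b e - h' b e) (mon 0 b (Suc c) e))"
    unfolding Dx_pow_dy_comb by (simp only: scale_left_diff_distrib sum_subtractf)
  also have "\<dots> \<in> order_span c"
  proof (intro subspace_sum[OF subspace_order_span])
    fix e b assume "e \<in> {..Suc E}"
    then show "scale (h b e - h' b e) (mon 0 b (Suc c) e) \<in> order_span c"
      using tangent_mon_mem_order_span[of b c e] subspace_scale[OF subspace_order_span] subspace_0[OF subspace_order_span]
      by (cases "Suc b < l") (auto simp: h'_def)
  qed
  finally have "(Dx ^^ Suc c) (dy_comb h (Suc E))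
      - ((Dx ^^ Suc c) (dy_comb h (Suc E)) - (Dx ^^ Suc c) (dy_comb h' (Suc E))) \<in> order_span c"
    using h_order_span subspace_diff[OF subspace_order_span] by blast
  then have "(Dx ^^ Suc c) (dy_comb h' (Suc E)) \<in> order_span c" by simp
  moreover have "Suc b < l \<and> e \<le> Suc E" if "h' b e \<noteq> 0" for b e
    using that by (auto simp: h'_def split: if_splits)
  ultimately have "h' b e = 0" for b e using Suc.IH[of h' "Suc E"] by blast
  then have "euler_coeff (Suc c) g b e = 0" if "Suc b < l" for b e
    using that h_0[of e b] unfolding h_def[symmetric] h'_def by (metis not_le)
  then show ?case by (rule euler_coeff_eq_0D) (use g in blast)+
qed

definition std_index where
  "std_index k = {(a, b, c, e). std a b c e \<and> a + b + c + e \<le> k}"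

lemma finite_std_index: "finite (std_index k)"
proof (rule finite_subset)
  show "std_index k \<subseteq> {..k} \<times> {..k} \<times> {..k} \<times> {..k}" by (auto simp: std_index_def)
qed simp

definition mon_at where "mon_at = (\<lambda>(a, b, c, e). mon a b c e)"

text \<open>Descending induction on the order in \<open>\<partial>\<^sub>x\<close> of a relation: its terms of highest order vanish by
  \<open>dy_comb_eq_0D\<close>, and a relation without \<open>\<partial>\<^sub>x\<close> is trivial by \<open>dy_sum_eq_0D\<close>.\<close>

lemma std_independent:
  assumes "(\<Sum>i\<in>std_index k. scale (g i) (mon_at i)) = 0" "i \<in> std_index k"
  shows "g i = 0"
proof -
  define h where "h i = (if i \<in> std_index k then g i else 0)" for i
  have h: "std a b c e \<and> a + b + c + e \<le> k" if "h (a, b, c, e) \<noteq> 0" for a b c e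
    using that by (auto simp: h_def std_index_def split: if_splits)
  have sum_0: "(\<Sum>i\<in>std_index k. scale (h i) (mon_at i)) = 0"
    using assms(1) by (simp add: h_def)
  have "h i = 0" if "\<And>a b c e. h (a, b, c, e) \<noteq> 0 \<Longrightarrow> c \<le> C" for C i
    using that
  proof (induction C)
    case 0
    then have c0: "c = 0" if "h (a, b, c, e) \<noteq> 0" for a b c e using that by blast
    define p where "p e = (\<Sum>b\<le>k. \<Sum>a\<le>k. monom (monom (h (a, b, 0, e)) a) b)" for e
    have coeff_p: "coeff (coeff (p e) b) a = h (a, b, 0, e)" for a b e
    proof -
      have "coeff (coeff (p e) b) a = (\<Sum>b'\<le>k. if b' = b then \<Sum>a'\<le>k. if a' = a then h (a, b, 0, e) else 0 else 0)"
        unfolding p_def coeff_sum by (intro sum.cong HOL.refl) (auto simp: coeff_sum)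
      then show ?thesis using h[of a b 0 e] by (cases "b \<le> k"; cases "a \<le> k") auto
    qed
    have ev_p: "ev (p e) = (\<Sum>b\<le>k. \<Sum>a\<le>k. scale (h (a, b, 0, e)) (X ^ a * Y ^ b))" for e
    proof -
      have "ev (monom (monom z a) b) = scale z (X ^ a * Y ^ b)" for z a b
      proof -
        have "monom z a = [:z:] * [:0, 1:] ^ a" by (simp add: monom_altdef)
        moreover have "(poly_x :: 'k poly poly) ^ a = [:[:0, 1:] ^ a:]"
          by (induction a) (simp_all add: poly_x_def one_pCons)
        ultimately have "monom (monom z a) b = [:[:z:]:] * (poly_x ^ a * poly_y ^ b)"
          by (simp add: monom_altdef[of _ b] poly_y_def)
        then show ?thesis by (simp only: scale_ev X_def Y_def ev_mult ev_power)
      qed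
      then show ?thesis by (simp add: p_def ev_sum)
    qed
    have "dy_sum p k = (\<Sum>e\<le>k. \<Sum>b\<le>k. \<Sum>a\<le>k. scale (h (a, b, 0, e)) (mon a b 0 e))"
      unfolding dy_sum_def ev_p
      by (simp add: sum_distrib_right Dy_pow_sum scale_mult_left Dy_pow_scale mult.assoc mon_def
          Xpow_Dy_pow)
    also have "\<dots> = (\<Sum>(e, b, a)\<in>{..k} \<times> {..k} \<times> {..k}. scale (h (a, b, 0, e)) (mon a b 0 e))"
      by (simp add: sum.cartesian_product)
    also have "\<dots> = (\<Sum>i\<in>(\<lambda>(e, b, a). (a, b, 0, e)) ` ({..k} \<times> {..k} \<times> {..k}). scale (h i) (mon_at i))"
      by (subst sum.reindex) (auto simp: inj_on_def mon_at_def intro!: sum.cong)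
    also have "\<dots> = (\<Sum>i\<in>std_index k. scale (h i) (mon_at i))"
    proof (rule sum.mono_neutral_cong)
      show "scale (h i) (mon_at i) = 0" if "i \<in> std_index k - (\<lambda>(e, b, a). (a, b, 0, e)) ` ({..k} \<times> {..k} \<times> {..k})" for i
      proof (cases i)
        case (fields a b c e)
        with that have "c \<noteq> 0" by (force simp: std_index_def image_iff)
        then show ?thesis using c0 fields by auto
      qed
    qed (auto simp: finite_std_index h_def)
    finally have "dy_sum p k = 0" using sum_0 by simp
    moreover have "degree (p e) < l" if "0 < e" for e
    proof (rule degree_lessI)
      have "coeff (p e) b = 0" if "l \<le> b" for b
        using h[of _ b 0 e] \<open>0 < e\<close> that by (intro poly_eqI) (auto simp: coeff_p std_def)
      then show "\<forall>b\<ge>l. coeff (p e) b = 0" by blast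
    qed (use l_pos in simp)
    ultimately have p0: "p e = 0" if "e \<le> k" for e
      using dy_sum_eq_0D that by blast
    show ?case
    proof (cases i)
      case (fields a b c e)
      show ?thesis
      proof (rule ccontr)
        assume "h i \<noteq> 0"
        then have "c = 0" "e \<le> k" using fields c0 h[of a b c e] by auto
        with p0[of e] coeff_p[of e b a] \<open>h i \<noteq> 0\<close> fields show False by simp
      qed
    qed
  next
    case (Suc C)
    define g' where "g' b e = h (0, b, Suc C, e)" for b e
    have g': "Suc b < l \<and> e \<le> k" if "g' b e \<noteq> 0" for b e
      using h[of 0 b "Suc C" e] that by (simp add: g'_def std_def)
    let ?J = "(\<lambda>(e, b). (0, b, Suc C, e)) ` ({..k} \<times> {..<l})"
    have "(Dx ^^ Suc C) (dy_comb g' k) = (\<Sum>(e, b)\<in>{..k} \<times> {..<l}. scale (g' b e) (mon 0 b (Suc C) e))"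
      unfolding Dx_pow_dy_comb by (simp add: sum.cartesian_product)
    also have "\<dots> = (\<Sum>i\<in>?J. scale (h i) (mon_at i))"
      by (subst sum.reindex) (auto simp: inj_on_def mon_at_def g'_def intro!: sum.cong)
    also have "\<dots> = (\<Sum>i\<in>std_index k \<inter> ?J. scale (h i) (mon_at i))"
      by (rule sum.mono_neutral_right) (auto simp: h_def)
    also have "\<dots> = - (\<Sum>i\<in>std_index k - ?J. scale (h i) (mon_at i))"
      using sum_0 sum.Int_Diff[OF finite_std_index, of "\<lambda>i. scale (h i) (mon_at i)" k ?J]
      by (simp add: eq_neg_iff_add_eq_0)
    also have "\<dots> \<in> order_span C"
    proof (intro subspace_neg[OF subspace_order_span] subspace_sum[OF subspace_order_span])
      fix i assume i: "i \<in> std_index k - ?J"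
      show "scale (h i) (mon_at i) \<in> order_span C"
      proof (cases i)
        case (fields a b c e)
        show ?thesis
        proof (cases "h i = 0")
          case False
          with Suc.prems fields have "c \<le> Suc C" by blast
          moreover have "c \<noteq> Suc C"
          proof
            assume "c = Suc C"
            then have "i \<in> ?J" using i fields by (auto simp: std_index_def std_def image_iff)
            with i show False by simp
          qed
          ultimately show ?thesis
            using mon_mem_order_span[of c C a b e] subspace_scale[OF subspace_order_span] by (simp add: fields mon_at_def)
        qed (simp add: subspace_0[OF subspace_order_span])
      qed
    qed
    finally have "g' b e = 0" for b e using dy_comb_eq_0D g' by blast
    then have "c \<le> C" if "h (a, b, c, e) \<noteq> 0" for a b c e
    proof -
      have "c \<le> Suc C" using Suc.prems that by blast
      moreover have "c \<noteq> Suc C"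
        using that h[OF that] \<open>\<And>b e. g' b e = 0\<close>[of b e] by (auto simp: g'_def std_def)
      ultimately show ?thesis by simp
    qed
    then show ?case by (rule Suc.IH)
  qed
  moreover have "c \<le> k" if "h (a, b, c, e) \<noteq> 0" for a b c e using h[OF that] by simp
  ultimately have "h i = 0" by blast
  with assms(2) show ?thesis by (simp add: h_def)
qed

end

section \<open>The Hilbert function\<close>

definition triangle :: "nat \<Rightarrow> (nat \<times> nat) set" where
  "triangle n = {(i, j). i + j \<le> n}"

lemma finite_triangle: "finite (triangle n)"
  by (rule finite_subset[of _ "{..n} \<times> {..n}"]) (auto simp: triangle_def)

lemma card_triangle: "real (card (triangle n)) = real ((n + 1) * (n + 2)) / 2"
proof (induction n)
  case 0
  have "triangle 0 = {(0, 0)}" by (auto simp: triangle_def)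
  then show ?case by simp
next
  case (Suc n)
  have "triangle (Suc n) = (\<lambda>(i, j). (Suc i, j)) ` triangle n \<union> {0} \<times> {..Suc n}"
  proof (intro equalityI subsetI)
    fix p assume "p \<in> triangle (Suc n)"
    moreover obtain i j where "p = (i, j)" by (cases p)
    ultimately show "p \<in> (\<lambda>(i, j). (Suc i, j)) ` triangle n \<union> {0} \<times> {..Suc n}"
      by (cases i) (auto simp: triangle_def image_iff)
  qed (auto simp: triangle_def)
  also have "card \<dots> = card ((\<lambda>(i, j). (Suc i, j)) ` triangle n) + card ({0::nat} \<times> {..Suc n})"
    by (rule card_Un_disjoint) (auto simp: finite_triangle)
  also have "card ((\<lambda>(i, j). (Suc i, j)) ` triangle n) = card (triangle n)"
    by (rule card_image) (auto simp: inj_on_def)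
  finally show ?case using Suc by (simp add: card_cartesian_product algebra_simps)
qed

context vector_space
begin

lemma inj_on_independent_of_sum_eq_0D:
  assumes "finite I" "\<And>g i. (\<Sum>i\<in>I. scale (g i) (v i)) = 0 \<Longrightarrow> i \<in> I \<Longrightarrow> g i = 0"
  shows "inj_on v I" "independent (v ` I)"
proof -
  show inj: "inj_on v I"
  proof (rule inj_onI, rule ccontr)
    fix i j assume ij: "i \<in> I" "j \<in> I" "v i = v j" "i \<noteq> j"
    define g where "g x = (if x = i then 1 else 0) - (if x = j then 1 else 0 :: 'a)" for x
    have "(\<Sum>x\<in>I. scale (g x) (v x)) =
        (\<Sum>x\<in>I. if x = i then v x else 0) - (\<Sum>x\<in>I. if x = j then v x else 0)"
      unfolding sum_subtractf[symmetric]
      by (rule sum.cong) (auto simp: g_def scale_left_diff_distrib)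
    also have "\<dots> = 0" using ij assms(1) by simp
    finally have "g i = 0" using assms(2) ij(1) by blast
    with ij show False by (simp add: g_def)
  qed
  show "independent (v ` I)"
  proof (rule independent_if_scalars_zero)
    fix f w assume f: "(\<Sum>x\<in>v ` I. scale (f x) x) = 0" and "w \<in> v ` I"
    then obtain i where i: "i \<in> I" "w = v i" by blast
    have "(\<Sum>i\<in>I. scale (f (v i)) (v i)) = 0"
      using f by (simp add: sum.reindex[OF inj])
    from assms(2)[OF this i(1)] show "f w = 0" by (simp add: i)
  qed (use assms(1) in simp)
qed

end

context fermat_complement
begin

text \<open>The filtrations of subspaces that contain \<open>u\<close> in degree \<open>0\<close> and are compatible with the degrees of
  the generators of the Weyl algebra. The smallest one is \<open>F\<^sub>k(D) u\<close>; this characterization is symmetric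
  in the two variables and does not refer to an order of the generators.\<close>

definition weyl_stable where
  "weyl_stable H \<longleftrightarrow> u \<in> H 0 \<and> (\<forall>k. subspace (H k) \<and>
     (\<forall>v\<in>H k. v \<in> H (Suc k) \<and> X * v \<in> H (Suc k) \<and> Y * v \<in> H (Suc k) \<and>
       Dx v \<in> H (Suc k) \<and> Dy v \<in> H (Suc k)))"

definition std_filtration where
  "std_filtration k = span (mon_at ` std_index k)"

lemma mon_mem_std_filtration: "a + b + c + e \<le> k \<Longrightarrow> mon a b c e \<in> std_filtration k"
proof -
  assume "a + b + c + e \<le> k"
  then have "mon a b c e \<in> std_span k c" by (rule mon_mem_std_span)
  also have "std_span k c \<subseteq> std_filtration k"
    unfolding std_span_def std_filtration_def by (rule span_mono) (force simp: mon_at_def std_index_def)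
  finally show ?thesis .
qed

lemma map_std_filtration:
  assumes "v \<in> std_filtration k" "\<And>v w. T (v + w) = T v + T w"
    "\<And>a v. T (scale a v) = scale a (T v)"
    "\<And>a b c e. a + b + c + e \<le> k \<Longrightarrow> T (mon a b c e) \<in> std_filtration (Suc k)"
  shows "T v \<in> std_filtration (Suc k)"
  unfolding std_filtration_def
proof (rule span_mapI[where T = T])
  show "v \<in> span (mon_at ` std_index k)" using assms(1) by (simp add: std_filtration_def)
  fix w assume "w \<in> mon_at ` std_index k"
  then obtain a b c e where "w = mon a b c e" "a + b + c + e \<le> k"
    by (force simp: mon_at_def std_index_def)
  then show "T w \<in> span (mon_at ` std_index (Suc k))"
    using assms(4) by (simp add: std_filtration_def)
qed (rule assms)+

lemma weyl_stable_std_filtration: "weyl_stable std_filtration"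
proof -
  note mem = mon_mem_std_filtration
  have sub: "subspace (std_filtration k)" for k
    unfolding std_filtration_def by (rule subspace_span)
  have of_nat: "of_nat n * v \<in> std_filtration k" if "v \<in> std_filtration k" for n v k
    using that unfolding std_filtration_def by (rule span_of_nat)
  have c0: "u \<in> std_filtration 0" using mem[of 0 0 0 0 0] by (simp add: mon_def)
  have c1: "v \<in> std_filtration (Suc k)" if "v \<in> std_filtration k" for v k
    using that by (rule map_std_filtration[where T = "\<lambda>v. v"]) (simp_all add: mem)
  have c2: "X * v \<in> std_filtration (Suc k)" if "v \<in> std_filtration k" for v k
    using that by (rule map_std_filtration[where T = "\<lambda>v. X * v"])
      (simp_all add: Rings.distrib_left scale_mult_right X_mon mem)
  have c3: "Y * v \<in> std_filtration (Suc k)" if "v \<in> std_filtration k" for v k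
    using that by (rule map_std_filtration[where T = "\<lambda>v. Y * v"])
      (simp_all add: Rings.distrib_left scale_mult_right Y_mon mem of_nat subspace_diff[OF sub])
  have c4: "Dx v \<in> std_filtration (Suc k)" if "v \<in> std_filtration k" for v k
    using that by (rule map_std_filtration[where T = "Dx"])
      (simp_all add: Dx_add Dx_scale Dx_mon mem of_nat subspace_add[OF sub])
  have c5: "Dy v \<in> std_filtration (Suc k)" if "v \<in> std_filtration k" for v k
    using that by (rule map_std_filtration[where T = "Dy"]) (simp_all add: Dy_add Dy_scale Dy_mon mem)
  show ?thesis
    unfolding weyl_stable_def
    by (intro conjI allI ballI c0 sub) (erule c1 c2 c3 c4 c5)+
qed

lemma weyl_stable_funpow:
  assumes H: "weyl_stable H" and v: "v \<in> H k"
  shows "X ^ n * v \<in> H (k + n)" "Y ^ n * v \<in> H (k + n)"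
    "(Dx ^^ n) v \<in> H (k + n)" "(Dy ^^ n) v \<in> H (k + n)"
proof -
  have closed: "X * v \<in> H (Suc k)" "Y * v \<in> H (Suc k)" "Dx v \<in> H (Suc k)" "Dy v \<in> H (Suc k)"
    if "v \<in> H k" for v k
    using H that unfolding weyl_stable_def by blast+
  show "X ^ n * v \<in> H (k + n)" "Y ^ n * v \<in> H (k + n)"
    "(Dx ^^ n) v \<in> H (k + n)" "(Dy ^^ n) v \<in> H (k + n)"
    by (induction n) (simp_all add: v closed mult.assoc)
qed

lemma std_filtration_least:
  assumes "weyl_stable H" shows "std_filtration k \<subseteq> H k"
proof -
  have "H i \<subseteq> H (Suc i)" for i using assms unfolding weyl_stable_def by blast
  then have mono: "H i \<subseteq> H j" if "i \<le> j" for i j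
    using that by (rule lift_Suc_mono_le)
  have "mon a b c e \<in> H k" if "a + b + c + e \<le> k" for a b c e
  proof -
    have "u \<in> H 0" using assms by (simp add: weyl_stable_def)
    then have "mon a b c e \<in> H (0 + b + e + c + a)"
      unfolding mon_def by (intro weyl_stable_funpow[OF assms])
    then show ?thesis using mono[of "0 + b + e + c + a" k] that by auto
  qed
  then show ?thesis
    unfolding std_filtration_def using assms
    by (intro span_minimal) (auto simp: weyl_stable_def mon_at_def std_index_def)
qed

lemma dim_least_weyl_stable:
  assumes "weyl_stable H" "\<And>G. weyl_stable G \<Longrightarrow> H k \<subseteq> G k"
  shows "dim (H k) = card (std_index k)"
proof -
  have H: "H k = std_filtration k"
    using assms weyl_stable_std_filtration std_filtration_least by blast
  have inj: "inj_on mon_at (std_index k)" and ind: "independent (mon_at ` std_index k)"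
    by (rule inj_on_independent_of_sum_eq_0D[OF finite_std_index], erule std_independent, assumption)+
  have "dim (std_filtration k) = card (mon_at ` std_index k)"
    unfolding std_filtration_def by (rule dim_span_eq_card_independent[OF ind])
  then show ?thesis by (simp add: H card_image[OF inj])
qed

text \<open>The three kinds of standard monomials, \<open>x\<^sup>a y\<^sup>b u\<close>, \<open>x\<^sup>a \<partial>\<^sub>y\<^sup>e\<^sup>+\<^sup>1 y\<^sup>b u\<close> and \<open>\<partial>\<^sub>x\<^sup>c\<^sup>+\<^sup>1 \<partial>\<^sub>y\<^sup>e y\<^sup>b u\<close>. In the last
  two only \<open>b\<close> is bounded, so each is a finite union of triangles; for \<open>k \<ge> l\<close> no subtraction
  \<open>k - (b + 1)\<close> truncates.\<close>

lemma std_index_partition: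
  assumes k: "l \<le> k"
  shows "std_index k = (\<lambda>(a, b). (a, b, 0, 0)) ` triangle k \<union>
    ((\<lambda>(b, a, e). (a, b, 0, Suc e)) ` Sigma {..<l} (\<lambda>b. triangle (k - Suc b)) \<union>
     (\<lambda>(b, c, e). (0, b, Suc c, e)) ` Sigma {..<l - 1} (\<lambda>b. triangle (k - Suc b)))"
    (is "_ = ?A \<union> (?B \<union> ?C)")
proof (intro equalityI subsetI)
  fix i assume "i \<in> std_index k"
  then obtain a b c e where i: "i = (a, b, c, e)" "std a b c e" "a + b + c + e \<le> k"
    by (auto simp: std_index_def)
  consider "c = 0" "e = 0" | e' where "c = 0" "e = Suc e'" "b < l"
    | c' where "c = Suc c'" "a = 0" "Suc b < l"
    using i(2) unfolding std_def by (cases c; cases e) auto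
  then show "i \<in> ?A \<union> (?B \<union> ?C)"
  proof cases
    case 1
    then have "(a, b) \<in> triangle k" using i by (simp add: triangle_def)
    from imageI[OF this, of "\<lambda>(a, b). (a, b, 0, 0)"] 1 have "i \<in> ?A" by (simp add: i)
    then show ?thesis by blast
  next
    case (2 e')
    then have "(b, a, e') \<in> Sigma {..<l} (\<lambda>b. triangle (k - Suc b))"
      using i(3) by (simp add: triangle_def)
    from imageI[OF this, of "\<lambda>(b, a, e). (a, b, 0, Suc e)"] have "i \<in> ?B" using 2 by (simp add: i)
    then show ?thesis by blast
  next
    case (3 c')
    then have "(b, c', e) \<in> Sigma {..<l - 1} (\<lambda>b. triangle (k - Suc b))"
      using i(3) by (simp add: triangle_def) linarith
    from imageI[OF this, of "\<lambda>(b, c, e). (0, b, Suc c, e)"] have "i \<in> ?C" using 3 by (simp add: i)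
    then show ?thesis by blast
  qed
next
  fix i assume "i \<in> ?A \<union> (?B \<union> ?C)"
  then consider "i \<in> ?A" | "i \<in> ?B" | "i \<in> ?C" by blast
  then show "i \<in> std_index k"
    by cases (use k in \<open>auto simp: std_index_def std_def triangle_def\<close>)
qed

lemma card_std_index_sum:
  assumes "l \<le> k"
  shows "card (std_index k) = card (triangle k) +
    ((\<Sum>b<l. card (triangle (k - Suc b))) + (\<Sum>b<l - 1. card (triangle (k - Suc b))))"
proof -
  define A :: "(nat \<times> nat \<times> nat \<times> nat) set"
    where "A = (\<lambda>(a, b). (a, b, 0, 0)) ` triangle k"
  define B :: "(nat \<times> nat \<times> nat \<times> nat) set"
    where "B = (\<lambda>(b, a, e). (a, b, 0, Suc e)) ` Sigma {..<l} (\<lambda>b. triangle (k - Suc b))"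
  define C :: "(nat \<times> nat \<times> nat \<times> nat) set"
    where "C = (\<lambda>(b, c, e). (0, b, Suc c, e)) ` Sigma {..<l - 1} (\<lambda>b. triangle (k - Suc b))"
  have "finite A" "finite B" "finite C"
    unfolding A_def B_def C_def by (simp_all add: finite_triangle)
  moreover have "B \<inter> C = {}" "A \<inter> (B \<union> C) = {}"
    unfolding A_def B_def C_def by auto
  ultimately have "card (A \<union> (B \<union> C)) = card A + (card B + card C)"
    by (simp only: card_Un_disjoint finite_Un)
  moreover have "card A = card (triangle k)"
    unfolding A_def by (rule card_image) (auto simp: inj_on_def)
  moreover have "card B = (\<Sum>b<l. card (triangle (k - Suc b)))"
    unfolding B_def by (subst card_image) (auto simp: inj_on_def finite_triangle)
  moreover have "card C = (\<Sum>b<l - 1. card (triangle (k - Suc b)))"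
    unfolding C_def by (subst card_image) (auto simp: inj_on_def finite_triangle)
  ultimately show ?thesis
    unfolding std_index_partition[OF assms] A_def B_def C_def by simp
qed

text \<open>Each of the \<open>1 + l + (l - 1)\<close> triangles contributes \<open>k\<^sup>2 / 2\<close> to the leading term.\<close>

lemma card_std_index:
  "\<exists>c0 c1. \<forall>k\<ge>l. real (card (std_index k)) = poly [:c0, c1, real l:] (real k)"
proof -
  define a0 where "a0 b = real b * (real b - 1) / 2" for b
  define a1 where "a1 b = (1 - 2 * real b) / 2" for b
  have tri: "real (card (triangle (k - Suc b))) = a0 b + a1 b * real k + real k ^ 2 / 2"
    if "b < l" "l \<le> k" for b k
  proof -
    have "Suc b \<le> k" using that by simp
    then obtain n where n: "k = Suc b + n" using le_Suc_ex by blast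
    then have "real k = 1 + real b + real n" "k - Suc b = n" by simp_all
    then show ?thesis
      by (simp add: card_triangle a0_def a1_def power2_eq_square field_simps)
  qed
  have sum: "(\<Sum>b<n. real (card (triangle (k - Suc b))))
      = sum a0 {..<n} + sum a1 {..<n} * real k + real n * (real k ^ 2 / 2)" if "n \<le> l" "l \<le> k" for n k
  proof -
    have "(\<Sum>b<n. real (card (triangle (k - Suc b)))) = (\<Sum>b<n. a0 b + a1 b * real k + real k ^ 2 / 2)"
      by (rule sum.cong) (use that tri in auto)
    then show ?thesis by (simp add: sum.distrib sum_distrib_right)
  qed
  have "real (card (std_index k)) =
      poly [:1 + sum a0 {..<l} + sum a0 {..<l - 1}, 3 / 2 + sum a1 {..<l} + sum a1 {..<l - 1}, real l:] (real k)"
    if k: "l \<le> k" for k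
  proof -
    have "real (card (triangle k)) = 1 + 3 / 2 * real k + real k ^ 2 / 2"
      by (simp add: card_triangle power2_eq_square field_simps)
    moreover have "real (l - 1) = real l - 1" using l_pos by simp
    ultimately show ?thesis
      unfolding card_std_index_sum[OF k] of_nat_add of_nat_sum
      using sum[OF _ k, of l] sum[OF _ k, of "l - 1"]
      by (simp add: power2_eq_square algebra_simps add_divide_distrib diff_divide_distrib)
  qed
  then show ?thesis by blast
qed

section \<open>Generation of \<open>K[x,y,f\<^sup>-\<^sup>1]\<close> by \<open>f\<^sup>-\<^sup>1\<close>\<close>

lemma ev_mult_mem:
  assumes "subspace A" "\<And>v. v \<in> A \<Longrightarrow> X * v \<in> A" "\<And>v. v \<in> A \<Longrightarrow> Y * v \<in> A" "v \<in> A"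
  shows "ev p * v \<in> A"
proof (induction p)
  case 0
  then show ?case using subspace_0[OF assms(1)] by simp
next
  case (pCons a p)
  have "ev [:a:] * v \<in> A"
  proof (induction a)
    case 0
    then show ?case using subspace_0[OF assms(1)] by simp
  next
    case (pCons z a)
    have "[:pCons z a:] = [:[:z:]:] + poly_x * [:a:]" by (simp add: poly_x_def)
    then have "ev [:pCons z a:] * v = scale z v + X * (ev [:a:] * v)"
      by (simp only: ev_add ev_mult scale_ev X_def Rings.distrib_right mult.assoc)
    then show ?case using pCons assms subspace_add[OF assms(1)] subspace_scale[OF assms(1)] by metis
  qed
  moreover have "pCons a p = [:a:] + poly_y * p" by (simp add: poly_y_def)
  then have "ev (pCons a p) * v = ev [:a:] * v + Y * (ev p * v)"
    by (simp only: ev_add ev_mult Y_def Rings.distrib_right mult.assoc)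
  ultimately show ?case using pCons assms subspace_add[OF assms(1)] by metis
qed

text \<open>Induction on \<open>n\<close>. The derivatives of \<open>u\<^sup>n\<close> give \<open>x\<^sup>m\<^sup>-\<^sup>1 u\<^sup>n\<^sup>+\<^sup>1\<close> and \<open>y\<^sup>l\<^sup>-\<^sup>1 u\<^sup>n\<^sup>+\<^sup>1\<close>. From there the exponents
  are lowered: the operator \<open>l \<partial>\<^sub>x x + m \<partial>\<^sub>y y\<close> multiplies \<open>x\<^sup>a y\<^sup>b u\<^sup>n\<^sup>+\<^sup>1\<close> by
  \<open>l (a + 1) + m (b + 1) - (n + 1) l m\<close>, which is negative for \<open>a + 1 < m\<close>, \<open>b + 1 < l\<close> and \<open>n \<ge> 1\<close>.\<close>

lemma ev_mult_u_power_mem: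
  assumes A: "subspace A" "\<And>v. v \<in> A \<Longrightarrow> X * v \<in> A" "\<And>v. v \<in> A \<Longrightarrow> Y * v \<in> A"
      "\<And>v. v \<in> A \<Longrightarrow> Dx v \<in> A" "\<And>v. v \<in> A \<Longrightarrow> Dy v \<in> A" and u: "u \<in> A"
  shows "ev p * u ^ n \<in> A"
proof -
  have cancel: "v \<in> A" if "of_nat j * v \<in> A" "0 < j" for j v
    using that span_of_nat_cancel[of j v A] span_eq_iff A(1) by metis
  have of_nat: "of_nat j * v \<in> A" if "v \<in> A" for j v
    using that by (simp add: of_nat_mult_eq_scale subspace_scale[OF A(1)])
  have mon: "X ^ a * Y ^ b * v \<in> A" if "v \<in> A" for a b v
    using ev_mult_mem[OF A(1-3) that, of "poly_x ^ a * poly_y ^ b"]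
    by (simp add: ev_mult ev_power X_def Y_def)
  have step: "u ^ Suc n \<in> A" if un: "u ^ n \<in> A" and n: "0 < n" for n
  proof -
    have Dxu: "Dx (u ^ n) = - (of_nat (n * m) * (X ^ (m - 1) * u ^ Suc n))"
      "Dy (u ^ n) = - (of_nat (n * l) * (Y ^ (l - 1) * u ^ Suc n))" for n
    proof -
      have p: "of_nat n * u ^ (n - 1) * u ^ 2 = of_nat n * u ^ Suc n"
        by (cases n) (simp_all add: power2_eq_square)
      have "Dx (u ^ n) = - (of_nat m * X ^ (m - 1) * (of_nat n * u ^ (n - 1) * u ^ 2))"
        "Dy (u ^ n) = - (of_nat l * Y ^ (l - 1) * (of_nat n * u ^ (n - 1) * u ^ 2))"
        unfolding Dx_power Dy_power Dx_u Dy_u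
        by (simp_all only: mult_minus_left mult_minus_right ac_simps)
      then show "Dx (u ^ n) = - (of_nat (n * m) * (X ^ (m - 1) * u ^ Suc n))"
        "Dy (u ^ n) = - (of_nat (n * l) * (Y ^ (l - 1) * u ^ Suc n))"
        unfolding p by (simp_all only: of_nat_mult ac_simps)
    qed
    have top': "of_nat (n * m) * (X ^ (m - 1) * u ^ Suc n) \<in> A"
      "of_nat (n * l) * (Y ^ (l - 1) * u ^ Suc n) \<in> A"
      using subspace_neg[OF A(1) A(4)[OF un]] subspace_neg[OF A(1) A(5)[OF un]]
      by (simp_all only: Dxu minus_minus)
    have top: "X ^ (m - 1) * u ^ Suc n \<in> A" "Y ^ (l - 1) * u ^ Suc n \<in> A"
      using cancel[OF top'(1)] cancel[OF top'(2)] n m_pos l_pos by simp_all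
    have "X ^ a * Y ^ b * u ^ Suc n \<in> A" for a b
    proof (induction "m + l - (a + b)" arbitrary: a b rule: less_induct)
      case less
      consider "m - 1 \<le> a" | "l - 1 \<le> b" | "Suc a < m" "Suc b < l" by linarith
      then show ?case
      proof cases
        case 1
        then obtain a' where a: "a = (m - 1) + a'" using le_Suc_ex by blast
        show ?thesis using mon[OF top(1), of a' b] by (simp only: a power_add ac_simps)
      next
        case 2
        then obtain b' where b: "b = (l - 1) + b'" using le_Suc_ex by blast
        show ?thesis using mon[OF top(2), of a b'] by (simp only: b power_add ac_simps)
      next
        case 3
        have lt: "l * Suc a + m * Suc b < l * m * Suc n"
        proof -
          have "l * Suc a < l * m" "m * Suc b < m * l"
            using 3 l_pos m_pos by (simp_all only: mult_less_cancel1)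
          moreover have "l * m * 2 \<le> l * m * Suc n" using n by (intro mult_le_mono2) simp
          ultimately show ?thesis by (simp only: mult.commute[of m l] mult_2_right)
        qed
        \<comment> \<open>\<open>w\<close> is an eigenvector of \<open>l \<partial>\<^sub>x x + m \<partial>\<^sub>y y\<close>, and \<open>x w\<close>, \<open>y w\<close> are in \<open>A\<close> by induction.\<close>
        define w where "w = X ^ a * Y ^ b * u ^ Suc n"
        have "X ^ Suc a * Y ^ b * u ^ Suc n \<in> A" "X ^ a * Y ^ Suc b * u ^ Suc n \<in> A"
          using 3 by (intro less.hyps; simp)+
        then have "of_nat l * Dx (X ^ Suc a * Y ^ b * u ^ Suc n)
            + of_nat m * Dy (X ^ a * Y ^ Suc b * u ^ Suc n) \<in> A"
          by (intro subspace_add[OF A(1)] of_nat A(4,5))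
        also have "of_nat l * Dx (X ^ Suc a * Y ^ b * u ^ Suc n) =
            of_nat l * (of_nat (Suc a) * w)
            - of_nat l * (of_nat (Suc n) * (of_nat m * (X ^ m * u * w)))"
        proof -
          have "Dx (X ^ Suc a * Y ^ b * u ^ Suc n) = of_nat (Suc a) * w
              - of_nat (Suc n) * (of_nat m * (X * X ^ (m - 1) * u * w))"
          proof -
            have "Dx (X ^ Suc a * Y ^ b * u ^ Suc n)
                = Dx (X ^ Suc a) * (Y ^ b * u ^ Suc n) + X ^ Suc a * Y ^ b * Dx (u ^ Suc n)"
              by (simp only: Dx_mult Dx_power[of Y] Dx_Y mult_zero_right mult_zero_left
                  add_0_right add_0_left Rings.distrib_left ac_simps)
            moreover have "Dx (X ^ Suc a) = of_nat (Suc a) * X ^ a"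
              by (simp only: Dx_power Dx_X diff_Suc_1 mult_1_right)
            moreover have "X ^ Suc a * Y ^ b * Dx (u ^ Suc n)
                = - (of_nat (Suc n) * (of_nat m * (X * X ^ (m - 1) * u * w)))"
              unfolding Dxu by (simp only: w_def power_Suc of_nat_mult mult_minus_right ac_simps)
            ultimately show ?thesis by (simp only: w_def diff_conv_add_uminus ac_simps)
          qed
          then show ?thesis unfolding power_pred[OF m_pos] by (simp only: right_diff_distrib)
        qed
        also have "of_nat m * Dy (X ^ a * Y ^ Suc b * u ^ Suc n) =
            of_nat m * (of_nat (Suc b) * w)
            - of_nat m * (of_nat (Suc n) * (of_nat l * (Y ^ l * u * w)))"
        proof -
          have "Dy (X ^ a * Y ^ Suc b * u ^ Suc n) = of_nat (Suc b) * w
              - of_nat (Suc n) * (of_nat l * (Y * Y ^ (l - 1) * u * w))"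
          proof -
            have "Dy (X ^ a * Y ^ Suc b * u ^ Suc n)
                = Dy (Y ^ Suc b) * (X ^ a * u ^ Suc n) + X ^ a * Y ^ Suc b * Dy (u ^ Suc n)"
              by (simp only: Dy_mult Dy_power[of X] Dy_X mult_zero_right mult_zero_left
                  add_0_right add_0_left Rings.distrib_left ac_simps)
            moreover have "Dy (Y ^ Suc b) = of_nat (Suc b) * Y ^ b"
              by (simp only: Dy_power Dy_Y diff_Suc_1 mult_1_right)
            moreover have "X ^ a * Y ^ Suc b * Dy (u ^ Suc n)
                = - (of_nat (Suc n) * (of_nat l * (Y * Y ^ (l - 1) * u * w)))"
              unfolding Dxu by (simp only: w_def power_Suc of_nat_mult mult_minus_right ac_simps)
            ultimately show ?thesis by (simp only: w_def diff_conv_add_uminus ac_simps)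
          qed
          then show ?thesis unfolding power_pred[OF l_pos] by (simp only: right_diff_distrib)
        qed
        also have "of_nat l * (of_nat (Suc a) * w) - of_nat l * (of_nat (Suc n) * (of_nat m * (X ^ m * u * w)))
            + (of_nat m * (of_nat (Suc b) * w) - of_nat m * (of_nat (Suc n) * (of_nat l * (Y ^ l * u * w))))
          = of_nat (l * Suc a + m * Suc b) * w
            - of_nat (l * m * Suc n) * (((X ^ m + Y ^ l) * u) * w)"
          by (simp only: of_nat_add of_nat_mult left_diff_distrib Rings.distrib_left
              Rings.distrib_right add_diff_eq diff_add_eq diff_diff_eq ac_simps)
        also have "\<dots> = - (of_nat (l * m * Suc n - (l * Suc a + m * Suc b)) * w)"
        proof -
          have "l * Suc a + m * Suc b \<le> l * m * Suc n" using lt by simp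
          then show ?thesis
            unfolding F_mult_u by (simp only: of_nat_diff mult_1 left_diff_distrib minus_diff_eq)
        qed
        finally have "of_nat (l * m * Suc n - (l * Suc a + m * Suc b)) * w \<in> A"
          using subspace_neg[OF A(1)] by (metis minus_minus)
        then show ?thesis unfolding w_def[symmetric] using cancel lt zero_less_diff by blast
      qed
    qed
    from this[of 0 0] show ?thesis by simp
  qed
  have pos: "u ^ n \<in> A" if "0 < n" for n
    using that
  proof (induction n rule: nat_induct_non_zero)
    case 1
    then show ?case using u by simp
  next
    case (Suc n)
    then show ?case using step by blast
  qed
  show ?thesis
  proof (cases "n = 0")
    case True
    \<comment> \<open>The step to higher powers starts at \<open>n = 1\<close>; polynomials themselves are \<open>(p f) u\<close>.\<close>
    have "ev (p * F) * u ^ 1 \<in> A" using ev_mult_mem[OF A(1-3) pos[of 1]] by simp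
    then show ?thesis using True ev_F_u by (simp add: ev_mult mult.assoc)
  next
    case False
    then show ?thesis using ev_mult_mem[OF A(1-3) pos[of n]] by simp
  qed
qed

end

section \<open>Exchanging the two variables\<close>

definition eval_hom :: "('a::comm_ring_1 \<Rightarrow> 'b::comm_ring_1) \<Rightarrow> 'b \<Rightarrow> 'a poly \<Rightarrow> 'b" where
  "eval_hom h t p = poly (map_poly h p) t"

lemma eval_hom_pCons:
  assumes "h 0 = 0"
  shows "eval_hom h t (pCons a p) = h a + t * eval_hom h t p"
  using assms by (cases "a = 0 \<and> p = 0") (auto simp: eval_hom_def map_poly_pCons)

lemma eval_hom_add:
  assumes "h 0 = 0" "\<And>a b. h (a + b) = h a + h b"
  shows "eval_hom h t (p + q) = eval_hom h t p + eval_hom h t q"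
proof (induction p arbitrary: q)
  case 0
  then show ?case by (simp add: eval_hom_def)
next
  case (pCons a p)
  show ?case
  proof (cases q)
    case (pCons b q')
    then show ?thesis
      by (simp add: eval_hom_pCons assms pCons.IH algebra_simps)
  qed
qed

lemma eval_hom_mult:
  assumes "h 0 = 0" "\<And>a b. h (a + b) = h a + h b" "\<And>a b. h (a * b) = h a * h b"
  shows "eval_hom h t (p * q) = eval_hom h t p * eval_hom h t q"
proof (induction p)
  case 0
  then show ?case by (simp add: eval_hom_def)
next
  case (pCons a p)
  have smult: "eval_hom h t (smult a q) = h a * eval_hom h t q"
  proof (induction q)
    case 0
    then show ?case by (simp add: eval_hom_def)
  next
    case (pCons b q)
    then show ?case by (simp add: eval_hom_pCons assms algebra_simps)
  qed
  show ?case
    by (simp add: eval_hom_add eval_hom_pCons assms smult pCons.IH algebra_simps)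
qed

definition swap_vars :: "'k::field poly poly \<Rightarrow> 'k poly poly" where
  "swap_vars = eval_hom (eval_hom (\<lambda>a. [:[:a:]:]) poly_y) poly_x"

lemma swap_vars_inner:
  "eval_hom (\<lambda>a. [:[:a:]:]) poly_y (0 :: 'k::field poly) = 0"
  "eval_hom (\<lambda>a. [:[:a:]:]) poly_y (p + q) =
     eval_hom (\<lambda>a. [:[:a:]:]) poly_y p + eval_hom (\<lambda>a. [:[:a:]:]) poly_y (q :: 'k::field poly)"
  "eval_hom (\<lambda>a. [:[:a:]:]) poly_y (p * q) =
     eval_hom (\<lambda>a. [:[:a:]:]) poly_y p * eval_hom (\<lambda>a. [:[:a:]:]) poly_y (q :: 'k::field poly)"
  by (simp_all add: eval_hom_def[of _ _ 0] eval_hom_add eval_hom_mult)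

lemma swap_vars_add: "swap_vars (p + q) = swap_vars p + swap_vars q"
  unfolding swap_vars_def by (rule eval_hom_add) (rule swap_vars_inner)+

lemma swap_vars_mult: "swap_vars (p * q) = swap_vars p * swap_vars q"
  unfolding swap_vars_def by (rule eval_hom_mult) (rule swap_vars_inner)+

lemma swap_vars_generators [simp]:
  "swap_vars 0 = 0" "swap_vars [:[:a:]:] = [:[:a:]:]" "swap_vars poly_x = poly_y" "swap_vars poly_y = poly_x"
  by (simp_all add: swap_vars_def eval_hom_def poly_x_def poly_y_def map_poly_pCons one_pCons)

lemma swap_vars_1: "swap_vars 1 = 1"
  using swap_vars_generators(2)[of 1] by (simp flip: one_pCons)

lemma bivariate_induct [case_names const x y add mult]:
  fixes p :: "'k::field poly poly"
  assumes "\<And>a. P [:[:a:]:]" "P poly_x" "P poly_y"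
    and "\<And>p q. P p \<Longrightarrow> P q \<Longrightarrow> P (p + q)" "\<And>p q. P p \<Longrightarrow> P q \<Longrightarrow> P (p * q)"
  shows "P p"
proof (induction p)
  case 0
  then show ?case using assms(1)[of 0] by simp
next
  case (pCons a p)
  have "P [:a:]"
  proof (induction a)
    case 0
    then show ?case using assms(1)[of 0] by simp
  next
    case (pCons z a)
    have "[:pCons z a:] = [:[:z:]:] + poly_x * [:a:]" by (simp add: poly_x_def)
    then show ?case using assms pCons by metis
  qed
  moreover have "pCons a p = [:a:] + poly_y * p" by (simp add: poly_y_def)
  ultimately show ?case using assms pCons by metis
qed

lemma swap_vars_swap_vars: "swap_vars (swap_vars p) = p"
  by (induction p rule: bivariate_induct) (simp_all add: swap_vars_add swap_vars_mult)

lemma swap_vars_deriv: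
  "poly_dx (swap_vars p) = swap_vars (poly_dy p)" "poly_dy (swap_vars p) = swap_vars (poly_dx p)"
  by (induction p rule: bivariate_induct)
    (simp_all add: swap_vars_1 swap_vars_add swap_vars_mult
      poly_dx_add poly_dy_add poly_dx_mult poly_dy_mult)

lemma swap_vars_power: "swap_vars (p ^ n) = swap_vars p ^ n"
  by (induction n) (simp_all add: swap_vars_mult swap_vars_1)

lemma ratfun_scale: "ratfun.scale a u = to_fract [:[:a:]:] * u"
  by (simp add: ratfun.scale_def ratfun_act_simps)

lemma fermat_complement_xy:
  assumes "0 < m" "m \<le> l"
  shows "fermat_complement (ratfun.scale :: 'k::field_char_0 \<Rightarrow> _) to_fract ratfun_dx ratfun_dy l m"
  by unfold_locales (use assms in \<open>simp_all add: ratfun_scale ratfun_d_simps ratfun_dx_dy\<close>)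

lemma fermat_complement_yx:
  assumes "0 < m" "m \<le> l"
  shows "fermat_complement (ratfun.scale :: 'k::field_char_0 \<Rightarrow> _) (to_fract \<circ> swap_vars)
    ratfun_dy ratfun_dx l m"
proof unfold_locales
  show "p = 0" if "(to_fract \<circ> swap_vars) p = 0" for p :: "'k poly poly"
  proof -
    have "swap_vars p = 0" using that by simp
    then have "swap_vars (swap_vars p) = 0" by simp
    then show ?thesis by (simp only: swap_vars_swap_vars)
  qed
qed (use assms in \<open>simp_all add: ratfun_scale ratfun_d_simps ratfun_dx_dy swap_vars_add
    swap_vars_mult swap_vars_deriv\<close>)

section \<open>The multiplicity of the localization\<close>

definition cyclic_filtration :: "'k::field poly poly fract \<Rightarrow> int \<Rightarrow> 'k poly poly fract set" where
  "cyclic_filtration u k = (\<lambda>p. ratfun_act p u) ` bernstein_filtration k"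

lemma subspace_act_image:
  "weyl.subspace B \<Longrightarrow> ratfun.subspace ((\<lambda>p. ratfun_act p u) ` B)"
  by (rule ratfun.subspaceI)
    (auto simp: ratfun.act_zero image_iff simp flip: ratfun.act_add_left ratfun.act_weyl_scale
      intro: bexI[of _ 0] weyl.subspace_0 weyl.subspace_add weyl.subspace_scale)

lemma good_filtration_cyclic:
  "ratfun.good_filtration (range (\<lambda>p. ratfun_act p u)) (cyclic_filtration u)"
  unfolding ratfun.good_filtration_def
proof (intro exI conjI allI)
  show "range (\<lambda>p. ratfun_act p u) = {\<Sum>i<1::nat. ratfun_act (P i) u | P. True}"
    by auto
  show "cyclic_filtration u k =
      {\<Sum>i<1::nat. ratfun_act (P i) u | P. \<forall>i<1. P i \<in> bernstein_filtration (k - 0)}" for k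
    unfolding cyclic_filtration_def by (auto simp: image_iff)
qed

text \<open>Here \<open>g1, \<dots>, g4\<close> are the generators of the Weyl algebra in either order of the variables. That
  \<open>F\<^sub>k(D) u\<close> is the least filtration compatible with the generators identifies its dimension with
  the number of standard monomials.\<close>

lemma multiplicity_localization:
  fixes ev :: "'k::field_char_0 poly poly \<Rightarrow> 'k poly poly fract" and f :: "'k poly poly"
  assumes fc: "fermat_complement ratfun.scale ev d1 d2 l m"
    and f: "ev (poly_x ^ m + poly_y ^ l) = to_fract f" "f \<noteq> 0"
    and onto: "range to_fract \<subseteq> range ev"
    and act: "\<And>v. ev poly_x * v = ratfun_act g1 v" "\<And>v. ev poly_y * v = ratfun_act g2 v"
      "\<And>v. d1 v = ratfun_act g3 v" "\<And>v. d2 v = ratfun_act g4 v"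
    and gens: "{g1, g2, g3, g4} = {weyl_x, weyl_y, weyl_dx, weyl_dy}"
  shows "ratfun.bernstein_multiplicity (localization f) = 2 * real l"
proof -
  interpret fc: fermat_complement ratfun.scale ev d1 d2 l m by (rule fc)
  define u where "u = inverse (to_fract f)"
  have u: "fc.u = u" by (simp add: fc.u_def fc.F_def f(1) u_def)
  have ops: "fc.X * v = ratfun_act g1 v" "fc.Y * v = ratfun_act g2 v"
      "d1 v = ratfun_act g3 v" "d2 v = ratfun_act g4 v" for v
    using act by (simp_all add: fc.X_def fc.Y_def)
  have stable_iff: "fc.weyl_stable H \<longleftrightarrow> u \<in> H 0 \<and> (\<forall>k. ratfun.subspace (H k) \<and>
      (\<forall>v\<in>H k. v \<in> H (Suc k) \<and> (\<forall>g\<in>{weyl_x, weyl_y, weyl_dx, weyl_dy}. ratfun_act g v \<in> H (Suc k))))" for H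
    unfolding fc.weyl_stable_def ops u gens[symmetric] by auto
  define H where "H n = cyclic_filtration u (int n)" for n
  have "fc.weyl_stable H"
    unfolding stable_iff
  proof (intro conjI allI ballI)
    show "u \<in> H 0"
      unfolding H_def cyclic_filtration_def using one_in_bernstein_filtration
      by (auto simp: image_iff ratfun.act_one intro!: bexI[of _ 1])
    show "ratfun.subspace (H k)" for k
      unfolding H_def cyclic_filtration_def
      by (rule subspace_act_image) (rule subspace_bernstein_filtration)
    fix k v assume "v \<in> H k"
    then obtain p where p: "p \<in> bernstein_filtration (int k)" "v = ratfun_act p u"
      unfolding H_def cyclic_filtration_def by blast
    show "v \<in> H (Suc k)"
      using p bernstein_filtration_mono[of "int k" "int (Suc k)"]
      unfolding H_def cyclic_filtration_def by auto
    fix g :: "'k weyl" assume "g \<in> {weyl_x, weyl_y, weyl_dx, weyl_dy}"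
    from generator_mult_bernstein_filtration[OF this p(1)]
    have "g * p \<in> bernstein_filtration (int (Suc k))" by (simp add: add.commute)
    then show "ratfun_act g v \<in> H (Suc k)"
      unfolding H_def cyclic_filtration_def p(2) by (simp flip: ratfun.act_mult)
  qed
  moreover have "H k \<subseteq> G k" if "fc.weyl_stable G" for G k
  proof -
    have G: "u \<in> G 0" "\<And>k. ratfun.subspace (G k)" "\<And>k. G k \<subseteq> G (Suc k)"
      "\<And>k v g. v \<in> G k \<Longrightarrow> g \<in> {weyl_x, weyl_y, weyl_dx, weyl_dy} \<Longrightarrow> ratfun_act g v \<in> G (Suc k)"
      using that unfolding stable_iff by blast+
    have pow: "ratfun_act (g ^ n) v \<in> G (k + n)"
      if v: "v \<in> G k" and g: "g \<in> {weyl_x, weyl_y, weyl_dx, weyl_dy}" for g n v k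
    proof (induction n)
      case (Suc n)
      from G(4)[OF this g] show ?case by (simp add: ratfun.act_mult)
    qed (simp add: ratfun.act_one v)
    have mon: "ratfun_act (weyl_monomial a b c e) u \<in> G k" if "int (a + b + c + e) \<le> int k" for a b c e
    proof -
      have "ratfun_act (weyl_monomial a b c e) u \<in> G (0 + e + c + b + a)"
        unfolding weyl_monomial_def ratfun.act_mult by (intro pow G(1)) simp_all
      moreover have "G (0 + e + c + b + a) \<subseteq> G k"
        using G(3) by (rule lift_Suc_mono_le) (use that in simp)
      ultimately show ?thesis by blast
    qed
    have "ratfun_act p u \<in> G k" if "p \<in> bernstein_filtration (int k)" for p
    proof -
      have "ratfun_act p u \<in> ratfun.span ((\<lambda>q. ratfun_act q u) `
          {weyl_monomial a b c e | a b c e. int (a + b + c + e) \<le> int k})"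
        using that unfolding bernstein_filtration_eq by (rule ratfun.act_in_span)
      also have "\<dots> \<subseteq> G k" by (rule ratfun.span_minimal[OF _ G(2)]) (use mon in auto)
      finally show ?thesis .
    qed
    then show ?thesis unfolding H_def cyclic_filtration_def by blast
  qed
  ultimately have dim: "ratfun.dim (H k) = card (fc.std_index k)" for k
    by (rule fc.dim_least_weyl_stable)
  obtain c0 c1 where card: "\<And>k. l \<le> k \<Longrightarrow> real (card (fc.std_index k)) = poly [:c0, c1, real l:] (real k)"
    using fc.card_std_index by blast
  have hilbert: "\<forall>\<^sub>F k in at_top. real (ratfun.dim (cyclic_filtration u k)) = poly [:c0, c1, real l:] (of_int k)"
    unfolding eventually_at_top_linorder
  proof (intro exI allI impI)
    fix k assume k: "int l \<le> k"
    then have nk: "k = int (nat k)" by simp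
    have "real (ratfun.dim (cyclic_filtration u k)) = real (card (fc.std_index (nat k)))"
      using dim[of "nat k"] nk by (simp add: H_def)
    also have "\<dots> = poly [:c0, c1, real l:] (real (nat k))" using k by (intro card) simp
    also have "real (nat k) = of_int k" using k by simp
    finally show "real (ratfun.dim (cyclic_filtration u k)) = poly [:c0, c1, real l:] (of_int k)" .
  qed
  let ?A = "range (\<lambda>p. ratfun_act p u)"
  have "localization f = ?A"
  proof (intro equalityI subsetI)
    fix v assume "v \<in> localization f"
    then obtain p n where v: "v = to_fract p * u ^ n"
      by (auto simp: localization_def u_def divide_inverse power_inverse)
    obtain q where q: "to_fract p = ev q" using onto by blast
    have closed: "ratfun_act g w \<in> ?A" if "w \<in> ?A" for g w
      using that by (auto simp flip: ratfun.act_mult)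
    have "ev q * fc.u ^ n \<in> ?A"
    proof (rule fc.ev_mult_u_power_mem)
      show "ratfun.subspace ?A" by (rule subspace_act_image) simp
      show "fc.u \<in> ?A" unfolding u by (rule range_eqI[of _ _ 1]) (simp add: ratfun.act_one)
    qed (unfold ops, (erule closed)+)
    then show "v \<in> ?A" by (simp add: v q u)
  next
    fix v assume "v \<in> ?A"
    moreover have "u \<in> localization f"
      unfolding localization_def by (intro CollectI exI[of _ 1]) (simp add: u_def divide_inverse)
    ultimately show "v \<in> localization f"
      using submodule_localization[OF f(2)] unfolding ratfun.submodule_def by blast
  qed
  then have "ratfun.good_filtration (localization f) (cyclic_filtration u)"
    using good_filtration_cyclic by simp
  from ratfun.bernstein_multiplicityI[OF this hilbert] show ?thesis
    using fc.l_pos by (simp add: numeral_2_eq_2)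
qed

theorem proposition4p4:
  fixes l m :: nat and f :: "'k::field_char_0 poly poly"
  assumes "l > 0" and "m > 0"
    and "f = poly_x ^ m + poly_y ^ l"
  shows "ratfun.bernstein_multiplicity (localization f) = 2 * real (max l m)"
proof (cases "m \<le> l")
  case True
  interpret fc: fermat_complement "ratfun.scale :: 'k \<Rightarrow> _" to_fract ratfun_dx ratfun_dy l m
    by (rule fermat_complement_xy) (use assms True in simp_all)
  have "f \<noteq> 0" using fc.F_nonzero unfolding fc.F_def assms(3)[symmetric] by auto
  then have "ratfun.bernstein_multiplicity (localization f) = 2 * real l"
    by (intro multiplicity_localization[OF fc.fermat_complement_axioms,
          where ?g1.0 = weyl_x and ?g2.0 = weyl_y and ?g3.0 = weyl_dx and ?g4.0 = weyl_dy])
      (simp_all add: assms(3) ratfun_act_simps)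
  then show ?thesis using True by (simp add: max_def)
next
  case False
  interpret fc: fermat_complement "ratfun.scale :: 'k \<Rightarrow> _" "to_fract \<circ> swap_vars"
    ratfun_dy ratfun_dx m l
    by (rule fermat_complement_yx) (use assms False in simp_all)
  have swap_F: "(to_fract \<circ> swap_vars) (poly_x ^ l + poly_y ^ m) = to_fract f"
    by (simp add: assms(3) swap_vars_add swap_vars_power add.commute)
  then have "f \<noteq> 0" using fc.F_nonzero by (auto simp: fc.F_def)
  moreover have "to_fract p \<in> range (to_fract \<circ> swap_vars)" for p :: "'k poly poly"
    by (rule range_eqI[of _ _ "swap_vars p"]) (simp add: swap_vars_swap_vars)
  ultimately have "ratfun.bernstein_multiplicity (localization f) = 2 * real m"
    using swap_F
    by (intro multiplicity_localization[OF fc.fermat_complement_axioms,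
          where ?g1.0 = weyl_y and ?g2.0 = weyl_x and ?g3.0 = weyl_dy and ?g4.0 = weyl_dx])
      (auto simp: ratfun_act_simps)
  then show ?thesis using False by (simp add: max_def)
qed

end
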